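(* Let $n$ be a positive integer. If two $m$-component welded string links $\sigma$ and $\sigma'$ are $(V^{n}+\mathrm{sv})$-equivalent, then $\mu^{\mathrm w}_{\sigma}(I)\equiv\mu^{\mathrm w}_{\sigma'}(I)\pmod n$ for every non-repeated sequence $I$ of elements of $\{1,\dots,m\}$.
   Context: Welded string links: equivalence classes of ordered oriented $m$-strand virtual string link diagrams (double points classical or virtual crossings) under welded Reidemeister moves R1–R3, V1–V4 and OC (welded isotopy). Welded Milnor invariants: label the arcs of the $i$th strand $a_{i1},\dots,a_{ir(i)}$ in order (arcs end at classical undercrossings); the Wirtinger presentation of $G(\sigma)$ has relations $a_{i,j+1}^{-1}u_{ij}^{-1}a_{ij}u_{ij}$ with $u_{ij}$ the over-arc generator at the relevant crossing or its inverse according to the crossing sign. Set $v_{ij}=u_{i1}\cdots u_{ij}$ and $l_i=a_{i1}^{s}v_{i,r(i)-1}$ with $s$ such that the total exponent of $i$th-component generators in $l_i$ is zero. Modulo the $q$th lower central series term, $l_i$ is a word $\lambda_i$ in the images $\alpha_1,\dots,\alpha_m$ of $a_{11},\dots,a_{m1}$; with Magnus expansion $E(\alpha_i)=1+X_i$, $E(\alpha_i^{-1})=\sum_{t\ge0}(-X_i)^t$ in $\mathbb Z\langle\langle X_1,\dots,X_m\rangle\rangle$, $\mu^{\mathrm w}_\sigma(j_1\dots j_k i)$ ($k<q$) is the coefficient of $X_{j_1}\cdots X_{j_k}$ in $E(\lambda_i)$. A sequence is non-repeated if its entries are pairwise distinct. A $V^n$-move: on two oriented strands in a disk, replace two parallel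 crossingless strands by a configuration where one strand passes under the other $n$ times consecutively at classical crossings of the same sign, crossing back via a virtual crossing after each (and the inverse). Self-crossing virtualization: replace a classical crossing between strands of the same component by a virtual one, or conversely. $(V^n+\mathrm{sv})$-equivalence is generated by $V^n$-moves, self-crossing virtualizations and welded isotopy. *)

theory Defs
  imports "HOL-Number_Theory.Cong"
begin

text \<open>A virtual string link diagram with m strands is encoded (up to the virtual moves
V1--V4, detour moves and planar isotopy, which do not change it) by its Gauss diagram:
for each strand i (1-based, stored at list index i-1) the sequence of classical crossing
endpoints met along the strand. An event (c, t, s) means: arrow (= classical crossing)
with identifier c, t = True iff this is the over-passage (tail of the arrow), t = False
iff it is the under-passage (head), s = True iff the crossing is positive.
Virtual crossings are not recorded.\<close>

type_synonym ev = "nat \<times> bool \<times> bool"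
type_synonym gdiag = "ev list list"

definition ev_id :: "ev \<Rightarrow> nat" where "ev_id e = fst e"
definition ev_tail :: "ev \<Rightarrow> bool" where "ev_tail e = fst (snd e)"
definition ev_pos :: "ev \<Rightarrow> bool" where "ev_pos e = snd (snd e)"

definition strand :: "gdiag \<Rightarrow> nat \<Rightarrow> ev list" where
  "strand D i = D ! (i - 1)"

definition ids :: "gdiag \<Rightarrow> nat set" where
  "ids D = ev_id ` set (concat D)"

definition wf_gd :: "nat \<Rightarrow> gdiag \<Rightarrow> bool" where
  "wf_gd m D \<longleftrightarrow> length D = m \<and>
     (\<forall>c \<in> ids D.
        length (filter (\<lambda>e. ev_id e = c \<and> ev_tail e) (concat D)) = 1 \<and>
        length (filter (\<lambda>e. ev_id e = c \<and> \<not> ev_tail e) (concat D)) = 1) \<and>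
     (\<forall>e \<in> set (concat D). \<forall>e' \<in> set (concat D). ev_id e = ev_id e' \<longrightarrow> ev_pos e = ev_pos e')"

definition ins :: "gdiag \<Rightarrow> nat \<Rightarrow> nat \<Rightarrow> ev list \<Rightarrow> gdiag" where
  "ins D i p L = D[i - 1 := take p (strand D i) @ L @ drop p (strand D i)]"

definition valid_pos :: "gdiag \<Rightarrow> nat \<Rightarrow> nat \<Rightarrow> bool" where
  "valid_pos D i p \<longleftrightarrow> 1 \<le> i \<and> i \<le> length D \<and> p \<le> length (strand D i)"

text \<open>Insert two blocks L1 (at strand i, position p) and L2 (at strand j, position q of the
diagram obtained after the first insertion) such that both blocks stay contiguous.\<close>
definition ins2 :: "gdiag \<Rightarrow> nat \<Rightarrow> nat \<Rightarrow> ev list \<Rightarrow> nat \<Rightarrow> nat \<Rightarrow> ev list \<Rightarrow> gdiag \<Rightarrow> bool" where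
  "ins2 D i p L1 j q L2 D' \<longleftrightarrow> valid_pos D i p \<and> valid_pos (ins D i p L1) j q \<and>
     (j \<noteq> i \<or> q \<le> p \<or> p + length L1 \<le> q) \<and> D' = ins (ins D i p L1) j q L2"

definition swp :: "gdiag \<Rightarrow> nat \<Rightarrow> nat \<Rightarrow> gdiag" where
  "swp D i p = D[i - 1 := (strand D i)[p := strand D i ! (p + 1), p + 1 := strand D i ! p]]"

definition valid_pair :: "gdiag \<Rightarrow> nat \<Rightarrow> nat \<Rightarrow> bool" where
  "valid_pair D i p \<longleftrightarrow> 1 \<le> i \<and> i \<le> length D \<and> p + 1 < length (strand D i)"

definition pair_at :: "gdiag \<Rightarrow> nat \<Rightarrow> nat \<Rightarrow> ev \<times> ev" where
  "pair_at D i p = (strand D i ! p, strand D i ! (p + 1))"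

definition loc_disj :: "nat \<times> nat \<Rightarrow> nat \<times> nat \<Rightarrow> bool" where
  "loc_disj x y \<longleftrightarrow> fst x \<noteq> fst y \<or> snd x + 2 \<le> snd y \<or> snd y + 2 \<le> snd x"

definition sgn_of :: "bool \<Rightarrow> int" where
  "sgn_of b = (if b then 1 else -1)"

definition fresh :: "gdiag \<Rightarrow> nat \<Rightarrow> bool" where
  "fresh D c \<longleftrightarrow> c \<notin> ids D"

definition R1 :: "gdiag \<Rightarrow> gdiag \<Rightarrow> bool" where
  "R1 D D' \<longleftrightarrow> (\<exists>i p c t s. valid_pos D i p \<and> fresh D c \<and>
       D' = ins D i p [(c, t, s), (c, \<not> t, s)])"

definition R2 :: "gdiag \<Rightarrow> gdiag \<Rightarrow> bool" where
  "R2 D D' \<longleftrightarrow> (\<exists>i p j q a b s L2. fresh D a \<and> fresh D b \<and> a \<noteq> b \<and>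
       (L2 = [(a, False, s), (b, False, \<not> s)] \<or> L2 = [(b, False, \<not> s), (a, False, s)]) \<and>
       ins2 D i p [(a, True, s), (b, True, \<not> s)] j q L2 D')"

text \<open>R3: three arrows a (top to middle), b (top to bottom), c (middle to bottom) with
endpoints on three disjoint short segments; the move reverses the order on each segment.
oT, oM, oB record the order of the endpoints on the top, middle, bottom segments; the
sign condition characterizes the configurations realized by three lines in a disk.\<close>
definition R3 :: "gdiag \<Rightarrow> gdiag \<Rightarrow> bool" where
  "R3 D D' \<longleftrightarrow> (\<exists>a b c sa sb sc iT pT iM pM iB pB oT oM oB.
       a \<noteq> b \<and> a \<noteq> c \<and> b \<noteq> c \<and>
       valid_pair D iT pT \<and> valid_pair D iM pM \<and> valid_pair D iB pB \<and>
       loc_disj (iT, pT) (iM, pM) \<and> loc_disj (iT, pT) (iB, pB) \<and> loc_disj (iM, pM) (iB, pB) \<and>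
       pair_at D iT pT = (if oT then ((a, True, sa), (b, True, sb)) else ((b, True, sb), (a, True, sa))) \<and>
       pair_at D iM pM = (if oM then ((a, False, sa), (c, True, sc)) else ((c, True, sc), (a, False, sa))) \<and>
       pair_at D iB pB = (if oB then ((b, False, sb), (c, False, sc)) else ((c, False, sc), (b, False, sb))) \<and>
       sgn_of sa * sgn_of oT * sgn_of oM = sgn_of sb * sgn_of oT * sgn_of oB \<and>
       sgn_of sb * sgn_of oT * sgn_of oB = sgn_of sc * sgn_of oM * sgn_of oB \<and>
       D' = swp (swp (swp D iT pT) iM pM) iB pB)"

definition OC :: "gdiag \<Rightarrow> gdiag \<Rightarrow> bool" where
  "OC D D' \<longleftrightarrow> (\<exists>i p. valid_pair D i p \<and> ev_tail (strand D i ! p) \<and>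
       ev_tail (strand D i ! (p + 1)) \<and> D' = swp D i p)"

definition rename :: "gdiag \<Rightarrow> gdiag \<Rightarrow> bool" where
  "rename D D' \<longleftrightarrow> (\<exists>f. inj f \<and> D' = map (map (\<lambda>(c, t, s). (f c, t, s))) D)"

definition welded_step :: "nat \<Rightarrow> gdiag \<Rightarrow> gdiag \<Rightarrow> bool" where
  "welded_step m D D' \<longleftrightarrow> wf_gd m D \<and> wf_gd m D' \<and>
     (R1 D D' \<or> R2 D D' \<or> R3 D D' \<or> OC D D' \<or> rename D D')"

definition welded_equiv :: "nat \<Rightarrow> gdiag \<Rightarrow> gdiag \<Rightarrow> bool" where
  "welded_equiv m = (\<lambda>D D'. welded_step m D D' \<or> welded_step m D' D)\<^sup>*\<^sup>*"

text \<open>V^n-move: one strand passes under another n times consecutively, all classical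
crossings of the same sign s: n consecutive heads on one segment, the n corresponding
tails consecutive on the other segment (in the same or reversed order).\<close>
definition Vn_move :: "nat \<Rightarrow> gdiag \<Rightarrow> gdiag \<Rightarrow> bool" where
  "Vn_move n D D' \<longleftrightarrow> (\<exists>cs s i p j q T. length cs = n \<and> distinct cs \<and> (\<forall>c \<in> set cs. fresh D c) \<and>
       (T = map (\<lambda>c. (c, True, s)) cs \<or> T = rev (map (\<lambda>c. (c, True, s)) cs)) \<and>
       ins2 D i p T j q (map (\<lambda>c. (c, False, s)) cs) D')"

text \<open>Self-crossing virtualization: a classical crossing between two points of the same
strand becomes virtual (the arrow is removed); the converse inserts such an arrow.\<close>
definition sv_move :: "gdiag \<Rightarrow> gdiag \<Rightarrow> bool" where
  "sv_move D D' \<longleftrightarrow> (\<exists>c t s i p q. fresh D c \<and> ins2 D i p [(c, t, s)] i q [(c, \<not> t, s)] D')"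

definition Vn_sv_step :: "nat \<Rightarrow> nat \<Rightarrow> gdiag \<Rightarrow> gdiag \<Rightarrow> bool" where
  "Vn_sv_step n m D D' \<longleftrightarrow> welded_step m D D' \<or>
     (wf_gd m D \<and> wf_gd m D' \<and> (Vn_move n D D' \<or> sv_move D D'))"

definition Vn_sv_equiv :: "nat \<Rightarrow> nat \<Rightarrow> gdiag \<Rightarrow> gdiag \<Rightarrow> bool" where
  "Vn_sv_equiv n m = (\<lambda>D D'. Vn_sv_step n m D D' \<or> Vn_sv_step n m D' D)\<^sup>*\<^sup>*"

text \<open>Arc (i, j): j-th arc (1-based) of strand i; arcs end at heads (undercrossings).
Words in the arc generators: lists of (generator, exponent +1 = True / -1 = False).\<close>

type_synonym 'g word = "('g \<times> bool) list"

definition winv :: "'g word \<Rightarrow> 'g word" where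
  "winv w = rev (map (\<lambda>(g, b). (g, \<not> b)) w)"

definition comm :: "'g word \<Rightarrow> 'g word \<Rightarrow> 'g word" where
  "comm x y = winv x @ winv y @ x @ y"

definition lcomm :: "'g word \<Rightarrow> 'g word list \<Rightarrow> 'g word" where
  "lcomm g gs = foldl comm g gs"

definition heads_before :: "ev list \<Rightarrow> nat \<Rightarrow> nat" where
  "heads_before xs k = length (filter (\<lambda>e. \<not> ev_tail e) (take k xs))"

definition tail_arc :: "gdiag \<Rightarrow> nat \<Rightarrow> nat \<times> nat" where
  "tail_arc D c = (SOME ij. \<exists>i k s. 1 \<le> i \<and> i \<le> length D \<and> k < length (strand D i) \<and>
       strand D i ! k = (c, True, s) \<and> ij = (i, 1 + heads_before (strand D i) k))"

definition heads_of :: "gdiag \<Rightarrow> nat \<Rightarrow> ev list" where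
  "heads_of D i = filter (\<lambda>e. \<not> ev_tail e) (strand D i)"

definition u_letter :: "gdiag \<Rightarrow> nat \<Rightarrow> nat \<Rightarrow> (nat \<times> nat) \<times> bool" where
  "u_letter D i j = (let e = heads_of D i ! (j - 1) in (tail_arc D (ev_id e), ev_pos e))"

definition relator :: "gdiag \<Rightarrow> nat \<Rightarrow> nat \<Rightarrow> (nat \<times> nat) word" where
  "relator D i j = [((i, j + 1), False)] @ winv [u_letter D i j] @ [((i, j), True)] @ [u_letter D i j]"

definition vword :: "gdiag \<Rightarrow> nat \<Rightarrow> (nat \<times> nat) word" where
  "vword D i = map (u_letter D i) [1..<length (heads_of D i) + 1]"

definition l_exp :: "gdiag \<Rightarrow> nat \<Rightarrow> int" where
  "l_exp D i = - (\<Sum>x \<leftarrow> vword D i. if fst (fst x) = i then sgn_of (snd x) else 0)"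

definition wpow :: "'g \<Rightarrow> int \<Rightarrow> 'g word" where
  "wpow g s = (if 0 \<le> s then replicate (nat s) (g, True) else replicate (nat (- s)) (g, False))"

definition longitude :: "gdiag \<Rightarrow> nat \<Rightarrow> (nat \<times> nat) word" where
  "longitude D i = wpow (i, 1) (l_exp D i) @ vword D i"

text \<open>Equality of words in G(D)/Gamma_q G(D): the congruence generated by free
cancellation, the Wirtinger relators, and all left-normed commutators of weight q.\<close>
inductive gcong :: "gdiag \<Rightarrow> nat \<Rightarrow> (nat \<times> nat) word \<Rightarrow> (nat \<times> nat) word \<Rightarrow> bool"
  for D :: gdiag and q :: nat where
  refl: "gcong D q w w"
| sym: "gcong D q w w' \<Longrightarrow> gcong D q w' w"
| trans: "gcong D q w w' \<Longrightarrow> gcong D q w' w'' \<Longrightarrow> gcong D q w w''"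
| ctxt: "gcong D q w w' \<Longrightarrow> gcong D q (x @ w @ y) (x @ w' @ y)"
| cancel: "gcong D q [(g, b), (g, \<not> b)] []"
| rel: "1 \<le> i \<Longrightarrow> i \<le> length D \<Longrightarrow> 1 \<le> j \<Longrightarrow> j \<le> length (heads_of D i) \<Longrightarrow>
         gcong D q (relator D i j) []"
| lcs: "length gs + 1 = q \<Longrightarrow> gcong D q (lcomm g gs) []"

text \<open>Magnus expansion E(alpha_i) = 1 + X_i, E(alpha_i^{-1}) = sum_t (-X_i)^t;
coefficient of the monomial X_{j1} ... X_{jk} (given as the list J).\<close>
definition mcoef_letter :: "nat list \<Rightarrow> nat \<times> bool \<Rightarrow> int" where
  "mcoef_letter J x = (if snd x then (if J = [] \<or> J = [fst x] then 1 else 0)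
                       else (if set J \<subseteq> {fst x} then (-1) ^ length J else 0))"

fun mcoef :: "nat list \<Rightarrow> nat word \<Rightarrow> int" where
  "mcoef J [] = (if J = [] then 1 else 0)"
| "mcoef J (x # w) = (\<Sum>k \<in> {0..length J}. mcoef_letter (take k J) x * mcoef (drop k J) w)"

text \<open>mu^w_D(j1 ... jk i): coefficient of X_{j1}...X_{jk} in E(lambda_i), where lambda_i
is a word in alpha_1..alpha_m (alpha_j = first arc (j,1)) equal to l_i modulo Gamma_q,
with q = k + 1.\<close>
definition mu :: "gdiag \<Rightarrow> nat list \<Rightarrow> int" where
  "mu D I = mcoef (butlast I)
     (SOME lam. fst ` set lam \<subseteq> {1..length D} \<and>
        gcong D (length I) (longitude D (last I)) (map (\<lambda>(j, b). ((j, 1), b)) lam))"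

end

theory Submission
  imports Defs
begin

text \<open>
  Colour the arcs of a diagram by words in the meridians $\alpha_1, \dots, \alpha_m$ so that the
  Wirtinger relations hold after Magnus expansion modulo $n$, modulo monomials with a repeated
  letter and modulo degree $q$. Such a colouring exists because conjugating $1 + X_i$ by an element
  known up to degree $t$ gives a result known up to degree $t + 1$. Commutators of weight $q$ vanish
  below degree $q$, so any colouring computes $\mu^w(Ji)$ modulo $n$ as the coefficient of $X_J$
      in the
  product of the colours met by strand $i$ at its undercrossings; the framing factor $a_{i1}^s$ does
  not matter since $i$ is not in $J$.

  Every move transports colourings. In the quotient $X_i r X_i = 0$ for all $r$, so conjugates of
  $1 + X_i$ commute with each other and are trivial modulo the ideal of $X_i$: deleting a
  self-crossing changes no colour and no relevant coefficient. Moreover $(1 + Y)^n = 1 + n Y = 1$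
  for a conjugate $Y$ of $X_i$, so the $n$ undercrossings of a $V^n$-move cancel.
\<close>

section \<open>Magnus coefficients\<close>

text \<open>Multiplicativity of the Magnus expansion: a coefficient of a product is a convolution
  over the cuts of \<open>J\<close>. In the induction step both sides sum over cuts of
  \<open>J\<close> into three pieces, taken in a different order.\<close>

lemma mcoef_append:
  "mcoef J (v @ w) = (\<Sum>k\<le>length J. mcoef (take k J) v * mcoef (drop k J) w)"
proof (induction v arbitrary: J)
  case Nil
  have "(\<Sum>k\<le>length J. mcoef (take k J) [] * mcoef (drop k J) w)
      = (\<Sum>k\<in>{0}. mcoef (take k J) [] * mcoef (drop k J) w)"
    by (intro sum.mono_neutral_right) auto
  then show ?case by simp
next
  case (Cons x v)
  define g where "g i j = mcoef_letter (take i J) x * (mcoef (take j (drop i J)) v * mcoef (drop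
      (i + j) J) w)"
    for i j
  have "mcoef J ((x # v) @ w) = (\<Sum>i\<le>length J. \<Sum>j\<le>length J - i. g i j)"
    by (simp add: Cons.IH g_def sum_distrib_left atLeast0AtMost add.commute)
  also have "\<dots> = (\<Sum>(i, j)\<in>{(i, j). i + j \<le> length J}. g i j)"
    by (subst sum.Sigma) (auto intro!: sum.cong)
  also have "\<dots> = (\<Sum>k\<le>length J. \<Sum>i\<le>k. g i (k - i))"
    by (rule sum.triangle_reindex_eq)
  also have "\<dots> = (\<Sum>k\<le>length J. mcoef (take k J) (x # v) * mcoef (drop k J) w)"
    by (intro sum.cong refl)
      (auto simp: g_def sum_distrib_right atLeast0AtMost min_def drop_take mult.assoc intro!:
          sum.cong)
  finally show ?case .
qed

lemma mcoef_Nil_seq [simp]: "mcoef [] w = 1"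
  by (induction w) (auto simp: mcoef_letter_def)

declare mcoef.simps(2) [simp del]

lemma mcoef_Cons_pos:
  "mcoef J ((i, True) # w) = mcoef J w + (if J \<noteq> [] \<and> hd J = i then mcoef (tl J) w else 0)"
proof (cases J)
  case (Cons x J')
  have "mcoef J ((i, True) # w)
      = (\<Sum>k\<in>{0, 1}. mcoef_letter (take k J) (i, True) * mcoef (drop k J) w)"
    unfolding mcoef.simps
    by (rule sum.mono_neutral_right) (auto simp: Cons mcoef_letter_def take_Cons')
  then show ?thesis by (simp add: Cons mcoef_letter_def)
qed (simp add: mcoef_letter_def)

lemma mcoef_single: "mcoef J [x] = mcoef_letter J x"
proof -
  have "mcoef J [x] = (\<Sum>k\<in>{length J}. mcoef_letter (take k J) x * mcoef (drop k J) [])"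
    unfolding mcoef.simps(2) by (rule sum.mono_neutral_right) auto
  then show ?thesis by simp
qed

lemma mcoef_cancel: "mcoef J [(g, b), (g, \<not> b)] = mcoef J []"
proof (cases b)
  case True
  then show ?thesis
    by (cases J) (simp_all add: mcoef_Cons_pos mcoef_single, auto simp: mcoef_letter_def)
next
  case False
  show ?thesis
  proof (cases J rule: rev_cases)
    case (snoc J' x)
    \<comment> \<open>The right factor 1 + X_g has degree at most one, so only the cuts leaving
      nothing or the last letter on the right survive. If both are nonzero, their powers of -1
      cancel.\<close>
    have "mcoef J [(g, b), (g, \<not> b)]
      = (\<Sum>k\<in>{length J', length J}. mcoef_letter (take k J) (g, False) * mcoef_letter (drop k J)
          (g, True))"
      unfolding mcoef.simps(2)[of J] using False
      by (simp only: simp_thms mcoef_single, intro sum.mono_neutral_right)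
        (auto simp: snoc mcoef_letter_def)
    then show ?thesis by (auto simp: snoc mcoef_letter_def)
  qed simp
qed

text \<open>From v (1 + X_i) w = v w + v X_i w: in the second summand the new X_i supplies one
  occurrence of \<open>i\<close> in \<open>J\<close>, and the pieces on either side come from
  \<open>v\<close> and \<open>w\<close>.\<close>

lemma mcoef_insert:
  "mcoef J (v @ [(i, True)] @ w) = mcoef J (v @ w) +
    (\<Sum>k<length J. if J ! k = i then mcoef (take k J) v * mcoef (drop (Suc k) J) w else 0)"
proof -
  have "mcoef J (v @ [(i, True)] @ w) = mcoef J (v @ w) +
    (\<Sum>k\<le>length J. mcoef (take k J) v *
       (if drop k J \<noteq> [] \<and> hd (drop k J) = i then mcoef (tl (drop k J)) w else 0))"
    by (simp add: mcoef_append mcoef_Cons_pos algebra_simps sum.distrib del: drop_eq_Nil)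
  also have "(\<Sum>k\<le>length J. mcoef (take k J) v *
       (if drop k J \<noteq> [] \<and> hd (drop k J) = i then mcoef (tl (drop k J)) w else 0))
    = (\<Sum>k<length J. mcoef (take k J) v *
       (if drop k J \<noteq> [] \<and> hd (drop k J) = i then mcoef (tl (drop k J)) w else 0))"
    by (rule sum.mono_neutral_right) auto
  also have "\<dots> = (\<Sum>k<length J. if J ! k
      = i then mcoef (take k J) v * mcoef (drop (Suc k) J) w else 0)"
    by (intro sum.cong) (auto simp: hd_drop_conv_nth tl_drop drop_Suc)
  finally show ?thesis .
qed

section \<open>Equality of Magnus expansions on a set of monomials\<close>

definition magnus_eq :: "nat \<Rightarrow> nat list set \<Rightarrow> nat word \<Rightarrow> nat word \<Rightarrow> bool" where
  "magnus_eq n P v w \<longleftrightarrow> (\<forall>J\<in>P. [mcoef J v = mcoef J w] (mod int n))"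

text \<open>Closure under prefixes and suffixes gives closure under all factors. The monomials
  outside \<open>P\<close> then span a two-sided ideal, and \<open>magnus_eq n P\<close> is equality
  in the quotient ring with coefficients modulo \<open>n\<close>.\<close>

definition factor_closed :: "nat list set \<Rightarrow> bool" where
  "factor_closed P \<longleftrightarrow> (\<forall>J\<in>P. \<forall>k. take k J \<in> P \<and> drop k J \<in> P)"

lemma magnus_eq_refl [simp]: "magnus_eq n P w w"
  by (simp add: magnus_eq_def)

lemma magnus_eq_sym: "magnus_eq n P v w \<Longrightarrow> magnus_eq n P w v"
  by (simp add: magnus_eq_def cong_sym)

lemma magnus_eq_trans [trans]:
  "magnus_eq n P u v \<Longrightarrow> magnus_eq n P v w \<Longrightarrow> magnus_eq n P u w"
  unfolding magnus_eq_def by (meson cong_trans)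

lemma magnus_eq_mono: "magnus_eq n P v w \<Longrightarrow> Q \<subseteq> P \<Longrightarrow> magnus_eq n Q v w"
  unfolding magnus_eq_def by blast

lemma magnus_eq_append:
  assumes "factor_closed P" "magnus_eq n P v v'" "magnus_eq n P w w'"
  shows "magnus_eq n P (v @ w) (v' @ w')"
  using assms unfolding magnus_eq_def factor_closed_def mcoef_append
  by (intro ballI cong_sum cong_mult) auto

lemma winv_append [simp]: "winv (v @ w) = winv w @ winv v"
  by (simp add: winv_def)

lemma winv_Nil [simp]: "winv [] = []"
  by (simp add: winv_def)

lemma winv_single [simp]: "winv [(g, b)] = [(g, \<not> b)]"
  by (simp add: winv_def)

lemma winv_Cons: "winv (x # w) = winv w @ [(fst x, \<not> snd x)]"
  by (simp add: winv_def case_prod_beta)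

lemma winv_winv [simp]: "winv (winv w) = w"
  by (induction w) (auto simp: winv_Cons)

lemma magnus_eq_right_inverse:
  assumes "factor_closed P"
  shows "magnus_eq n P (w @ winv w) []"
proof (induction w)
  case (Cons x w)
  have "magnus_eq n P ([x] @ (w @ winv w) @ [(fst x, \<not> snd x)]) ([x] @ [] @ [(fst x, \<not> snd x)])"
    by (intro magnus_eq_append assms Cons magnus_eq_refl)
  also have "magnus_eq n P \<dots> []"
    using mcoef_cancel[of _ "fst x" "snd x"] unfolding magnus_eq_def by simp
  finally show ?case by (simp add: winv_Cons)
qed simp

lemma magnus_eq_left_inverse:
  "factor_closed P \<Longrightarrow> magnus_eq n P (winv w @ w) []"
  using magnus_eq_right_inverse[of P n "winv w"] by simp

lemma magnus_eq_cancel_mid: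
  assumes "factor_closed P" "magnus_eq n P w []"
  shows "magnus_eq n P (u @ w @ v) (u @ v)"
  using magnus_eq_append[OF assms(1) magnus_eq_refl[of n P u]
      magnus_eq_append[OF assms magnus_eq_refl[of n P v]]] by simp

lemma magnus_eq_winv:
  assumes P: "factor_closed P" and e: "magnus_eq n P v w"
  shows "magnus_eq n P (winv v) (winv w)"
proof -
  have "magnus_eq n P (winv v @ (w @ winv w) @ []) (winv v @ [])"
    by (rule magnus_eq_cancel_mid[OF P magnus_eq_right_inverse[OF P]])
  then have "magnus_eq n P (winv v) (winv v @ w @ winv w)"
    by (simp add: magnus_eq_sym)
  also have "magnus_eq n P (winv v @ w @ winv w) (winv v @ v @ winv w)"
    by (intro magnus_eq_append P magnus_eq_refl magnus_eq_sym[OF e])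
  also have "magnus_eq n P (winv v @ v @ winv w) (winv w)"
    using magnus_eq_cancel_mid[OF P magnus_eq_left_inverse[OF P], of n "[]" v "winv w"] by simp
  finally show ?thesis .
qed

definition conj_gen :: "nat \<Rightarrow> nat word \<Rightarrow> nat word" where
  "conj_gen i w = winv w @ [(i, True)] @ w"

text \<open>In w^{-1} (1 + X_i) w = w^{-1} w + w^{-1} X_i w the first summand is 1 for every
  \<open>w\<close>, and the second sees \<open>w\<close> only on the pieces of \<open>J\<close>
  before and after a letter \<open>i\<close>. So agreement of the conjugators on a smaller set
  \<open>Q\<close> can give agreement on a larger \<open>P\<close>.\<close>

lemma conj_gen_cong:
  assumes Q: "factor_closed Q" and e: "magnus_eq n Q v w"
    and PQ: "\<And>J k. J \<in> P \<Longrightarrow> k < length J \<Longrightarrow> J ! k = i \<Longrightarrow> take k J \<in> Q \<and> drop (Suc k) J \<in> Q"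
  shows "magnus_eq n P (conj_gen i v) (conj_gen i w)"
  unfolding magnus_eq_def conj_gen_def
proof
  fix J assume J: "J \<in> P"
  \<comment> \<open>\<open>P\<close> is an arbitrary set of monomials here, so the cancellation is
    done on all monomials.\<close>
  have UNIV: "factor_closed UNIV" by (simp add: factor_closed_def)
  have "[mcoef J (winv v @ v) = mcoef J []] (mod int n)"
      "[mcoef J (winv w @ w) = mcoef J []] (mod int n)"
    using magnus_eq_left_inverse[OF UNIV, of n] unfolding magnus_eq_def by blast+
  then have 1: "[mcoef J (winv v @ v) = mcoef J (winv w @ w)] (mod int n)"
    by (meson cong_sym cong_trans)
  show "[mcoef J (winv v @ [(i, True)] @ v) = mcoef J (winv w @ [(i, True)] @ w)] (mod int n)"
    unfolding mcoef_insert
  proof (intro cong_add 1 cong_sum)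
    fix k assume "k \<in> {..<length J}"
    then have "J ! k = i \<Longrightarrow> [mcoef (take k J) (winv v) * mcoef (drop (Suc k) J) v
        = mcoef (take k J) (winv w) * mcoef (drop (Suc k) J) w] (mod int n)"
      using PQ[OF J, of k] e magnus_eq_winv[OF Q e] unfolding magnus_eq_def
      by (intro cong_mult) auto
    then show "[(if J ! k = i then mcoef (take k J) (winv v) * mcoef (drop (Suc k) J) v else 0)
        = (if J ! k = i then mcoef (take k J) (winv w) * mcoef (drop (Suc k) J) w else 0)]
            (mod int n)"
      by simp
  qed
qed

section \<open>Colourings\<close>

definition signed :: "bool \<Rightarrow> 'g word \<Rightarrow> 'g word" where
  "signed b w = (if b then w else winv w)"

definition under_word :: "(nat \<Rightarrow> nat word) \<Rightarrow> ev list \<Rightarrow> nat word" where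
  "under_word U xs = concat (map (\<lambda>e. if ev_tail e then []
      else signed (ev_pos e) (U (ev_id e))) xs)"

definition nonrep :: "nat \<Rightarrow> nat list set" where
  "nonrep q = {J. distinct J \<and> length J < q}"

text \<open>The monomials J for which the sequence J followed by \<open>i\<close> is non-repeated:
  those that matter for the longitude of strand \<open>i\<close>. Restricting to them also kills the
  ideal generated by X_i.\<close>

definition nonrep_off :: "nat \<Rightarrow> nat \<Rightarrow> nat list set" where
  "nonrep_off q i = {J. distinct J \<and> length J < q \<and> i \<notin> set J}"

text \<open>$U(c)$ is the colour of the over-arc of crossing $c$. The colour of an arc of strand $i$ is
  $W^{-1} \alpha_i W$, where $W$ is the product of the signed colours met at the undercrossings
  before that arc.\<close>
definition colouring :: "nat \<Rightarrow> nat \<Rightarrow> gdiag \<Rightarrow> (nat \<Rightarrow> nat word) \<Rightarrow> bool" where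
  "colouring n q D U \<longleftrightarrow> (\<forall>i k. 1 \<le> i \<longrightarrow> i \<le> length D \<longrightarrow> k < length (strand D i) \<longrightarrow>
      ev_tail (strand D i ! k) \<longrightarrow>
      magnus_eq n (nonrep q) (U (ev_id (strand D i ! k)))
        (conj_gen i (under_word U (take k (strand D i)))))"

lemma factor_closed_nonrep: "factor_closed (nonrep q)"
  by (auto simp: factor_closed_def nonrep_def)

lemma factor_closed_nonrep_off: "factor_closed (nonrep_off q i)"
  by (auto simp: factor_closed_def nonrep_off_def dest: in_set_takeD in_set_dropD)

lemma nonrep_off_subset: "nonrep_off q i \<subseteq> nonrep q"
  by (auto simp: nonrep_def nonrep_off_def)

lemma under_word_append [simp]: "under_word U (xs @ ys) = under_word U xs @ under_word U ys"
  by (simp add: under_word_def)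

lemma under_word_Nil [simp]: "under_word U [] = []"
  by (simp add: under_word_def)

lemma under_word_Cons:
  "under_word U (e # xs) = (if ev_tail e then []
      else signed (ev_pos e) (U (ev_id e))) @ under_word U xs"
  by (simp add: under_word_def)

lemma under_word_heads: "under_word U (filter (\<lambda>e. \<not> ev_tail e) xs) = under_word U xs"
  by (induction xs) (auto simp: under_word_Cons)

lemma magnus_eq_signed:
  "factor_closed P \<Longrightarrow> magnus_eq n P v w \<Longrightarrow> magnus_eq n P (signed b v) (signed b w)"
  by (simp add: signed_def magnus_eq_winv)

lemma under_word_cong:
  assumes "factor_closed P" "\<And>e. e \<in> set xs \<Longrightarrow> \<not> ev_tail e \<Longrightarrow>
      magnus_eq n P (U (ev_id e)) (U' (ev_id e))"
  shows "magnus_eq n P (under_word U xs) (under_word U' xs)"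
  using assms(2)
  by (induction xs) (auto simp: under_word_Cons intro!: magnus_eq_append magnus_eq_signed assms(1))

text \<open>A repetition-free monomial that contains $X_i$ splits around $X_i$ into monomials free of
  $X_i$, so conjugates of $1 + X_i$ only see the conjugator modulo the ideal generated by $X_i$.\<close>
lemma conj_gen_cong_off:
  "magnus_eq n (nonrep_off q i) v w \<Longrightarrow> magnus_eq n (nonrep q) (conj_gen i v) (conj_gen i w)"
proof (erule conj_gen_cong[OF factor_closed_nonrep_off])
  fix J k assume J: "J \<in> nonrep q" "k < length J" "J ! k = i"
  then have "distinct (take k J @ J ! k # drop (Suc k) J)" "length J < q"
    using id_take_nth_drop[of k J] unfolding nonrep_def by auto
  then show "take k J \<in> nonrep_off q i \<and> drop (Suc k) J \<in> nonrep_off q i"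
    using J by (auto simp: nonrep_off_def)
qed

text \<open>Modulo X_i the generator 1 + X_i becomes 1, and so does every conjugate of it. This
  makes self-crossings and framing factors invisible.\<close>

lemma conj_gen_trivial_off: "magnus_eq n (nonrep_off q i) (conj_gen i w) []"
proof -
  have "magnus_eq n (nonrep_off q i) [(i, True)] []"
    by (auto simp: magnus_eq_def mcoef_single mcoef_letter_def nonrep_off_def)
  then have "magnus_eq n (nonrep_off q i) (conj_gen i w) (winv w @ w)"
    unfolding conj_gen_def by (rule magnus_eq_cancel_mid[OF factor_closed_nonrep_off])
  also have "magnus_eq n (nonrep_off q i) (winv w @ w) []"
    by (rule magnus_eq_left_inverse[OF factor_closed_nonrep_off])
  finally show ?thesis .
qed

section \<open>Powers of conjugates of a generator\<close>

definition word_pow :: "'g word \<Rightarrow> nat \<Rightarrow> 'g word" where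
  "word_pow w k = concat (replicate k w)"

lemma word_pow_0 [simp]: "word_pow w 0 = []"
  by (simp add: word_pow_def)

lemma word_pow_Suc [simp]: "word_pow w (Suc k) = w @ word_pow w k"
  by (simp add: word_pow_def)

text \<open>In the binomial expansion of (1 + X_i)^k every term of degree at least two repeats X_i,
  so only 1 + k X_i is seen by a repetition-free \<open>J\<close>.\<close>

lemma mcoef_pow:
  "distinct J \<Longrightarrow> mcoef J (word_pow [(i, True)] k) = (if J = [] then 1 else if J = [i]
      then int k else 0)"
proof (induction k arbitrary: J)
  case (Suc k)
  then show ?case
    by (cases J) (auto simp: mcoef_Cons_pos)
qed auto

lemma magnus_eq_conj_pow:
  assumes P: "factor_closed P"
  shows "magnus_eq n P (word_pow (conj_gen i w) k) (winv w @ word_pow [(i, True)] k @ w)"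
proof (induction k)
  case 0
  then show ?case by (simp add: magnus_eq_sym magnus_eq_left_inverse[OF P])
next
  case (Suc k)
  have "magnus_eq n P (word_pow (conj_gen i w) (Suc k))
      (conj_gen i w @ winv w @ word_pow [(i, True)] k @ w)"
    using magnus_eq_append[OF P magnus_eq_refl Suc] by simp
  also have "magnus_eq n P \<dots> (winv w @ word_pow [(i, True)] (Suc k) @ w)"
    using magnus_eq_cancel_mid[OF P magnus_eq_right_inverse[OF P],
        of n "winv w @ [(i, True)]" w "word_pow [(i, True)] k @ w"]
    by (simp add: conj_gen_def)
  finally show ?case .
qed

lemma word_pow_cong:
  "factor_closed P \<Longrightarrow> magnus_eq n P v w \<Longrightarrow> magnus_eq n P (word_pow v k) (word_pow w k)"
  by (induction k) (auto intro: magnus_eq_append)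

lemma winv_concat: "winv (concat ws) = concat (rev (map winv ws))"
  by (induction ws) auto

lemma winv_word_pow: "winv (word_pow w k) = word_pow (winv w) k"
  by (simp add: word_pow_def winv_concat rev_map)

text \<open>Modulo repetitions $(1 + Y)^n = 1 + n Y$ for a conjugate $Y$ of $X_i$.\<close>
lemma conj_gen_pow_trivial:
  assumes "magnus_eq n (nonrep q) u (conj_gen i w)"
  shows "magnus_eq n (nonrep q) (word_pow (signed b u) n) []"
proof -
  let ?P = "nonrep q"
  note P = factor_closed_nonrep
  have "magnus_eq n ?P (word_pow u n) (word_pow (conj_gen i w) n)"
    by (rule word_pow_cong[OF P assms])
  also have "magnus_eq n ?P \<dots> (winv w @ word_pow [(i, True)] n @ w)"
    by (rule magnus_eq_conj_pow[OF P])
  also have "magnus_eq n ?P \<dots> (winv w @ w)"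
  proof (rule magnus_eq_cancel_mid[OF P])
    show "magnus_eq n ?P (word_pow [(i, True)] n) []"
      by (auto simp: magnus_eq_def mcoef_pow nonrep_def cong_0_iff)
  qed
  also have "magnus_eq n ?P (winv w @ w) []"
    by (rule magnus_eq_left_inverse[OF P])
  finally have u: "magnus_eq n ?P (word_pow u n) []" .
  then show ?thesis
    using magnus_eq_winv[OF P u] by (simp add: signed_def winv_word_pow[symmetric])
qed

lemma winv_signed: "winv (signed b w) = signed (\<not> b) w"
  by (simp add: signed_def)

section \<open>Endpoints of crossings and existence of colourings\<close>

lemma unique_position:
  assumes "length (filter P (concat D)) \<le> 1"
    "a < length D" "k < length (D ! a)" "P (D ! a ! k)" "b < length D" "l < length (D ! b)"
        "P (D ! b ! l)"
  shows "a = b \<and> k = l"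
  using assms
proof (induction D arbitrary: a b)
  case (Cons xs D)
  have mem: "filter P xs \<noteq> []" if "k < length xs" "P (xs ! k)" for k
    using that by (auto simp: filter_empty_conv)
  have mem': "filter P (concat D) \<noteq> []" if "a < length D" "k < length (D ! a)"
      "P (D ! a ! k)" for a k
    using that by (auto simp: filter_empty_conv intro!: bexI[of _ "D ! a"] bexI[of _ "D ! a ! k"])
  have len: "length (filter P xs) + length (filter P (concat D)) \<le> 1" using Cons.prems(1) by simp
  then have excl: "filter P xs = [] \<or> filter P (concat D) = []"
    by (cases "filter P xs"; cases "filter P (concat D)") auto
  show ?case
  proof (cases a)
    case 0
    with Cons.prems have a: "k < length xs" "P (xs ! k)" by simp_all
    then have b: "b = 0" using mem[of k] mem'[of "b - 1" l] excl Cons.prems by (cases b) auto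
    with Cons.prems have b': "l < length xs" "P (xs ! l)" by simp_all
    \<comment> \<open>The length of a filtered list counts the matching positions.\<close>
    have "card {j. j < length xs \<and> P (xs ! j)} \<le> 1"
      using len by (simp add: length_filter_conv_card)
    then have "k = l" using a b' card_le_Suc0_iff_eq[of "{j. j < length xs \<and> P (xs ! j)}"] by auto
    then show ?thesis using 0 b by simp
  next
    case (Suc a')
    with Cons.prems have a: "a' < length D" "k < length (D ! a')" "P (D ! a' ! k)" by simp_all
    then have "b \<noteq> 0" using mem[of l] mem'[of a' k] excl Cons.prems by (cases b) auto
    then obtain b' where b': "b = Suc b'" by (cases b) auto
    show ?thesis using Cons.IH[of a' b'] Cons.prems len a b' Suc by simp
  qed
qed simp

lemma wf_gd_unique:
  assumes wf: "wf_gd m D" and i: "1 \<le> i" "i \<le> length D" "k < length (strand D i)"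
    and j: "1 \<le> j" "j \<le> length D" "l < length (strand D j)"
    and same: "ev_id (strand D i ! k) = ev_id (strand D j ! l)"
        "ev_tail (strand D i ! k) = ev_tail (strand D j ! l)"
  shows "i = j \<and> k = l"
proof -
  let ?c = "ev_id (strand D i ! k)" and ?t = "ev_tail (strand D i ! k)"
  have "strand D i ! k \<in> set (concat D)"
    using i by (auto simp: strand_def intro!: bexI[of _ "D ! (i - 1)"])
  then have "?c \<in> ids D" by (simp add: ids_def)
  then have "length (filter (\<lambda>e. ev_id e = ?c \<and> ev_tail e = ?t) (concat D)) = 1"
    using wf unfolding wf_gd_def by (cases ?t) auto
  then have "i - 1 = j - 1 \<and> k = l"
    using i j same
    by (intro unique_position[where P =
        "\<lambda>e. ev_id e = ?c \<and> ev_tail e = ?t" and D = D]) (auto simp: strand_def)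
  then show ?thesis using i j by auto
qed

text \<open>\<open>tail_arc\<close> names only an arc, whereas the recursion in \<open>chen\<close>
  needs the position of the tail along its strand. For a tail present in a well-formed diagram the
  choice is forced by \<open>tail_pos_eq\<close>.\<close>

definition tail_pos :: "gdiag \<Rightarrow> nat \<Rightarrow> nat \<times> nat" where
  "tail_pos D c = (SOME (i, k). 1 \<le> i \<and> i \<le> length D \<and> k < length (strand D i) \<and>
     ev_tail (strand D i ! k) \<and> ev_id (strand D i ! k) = c)"

lemma tail_pos_eq:
  assumes "wf_gd m D" "1 \<le> i" "i \<le> length D" "k < length (strand D i)" "ev_tail (strand D i ! k)"
  shows "tail_pos D (ev_id (strand D i ! k)) = (i, k)"
  unfolding tail_pos_def
proof (rule some_equality)
  fix y assume "case y of (j, l) \<Rightarrow> 1 \<le> j \<and> j \<le> length D \<and> l < length (strand D j) \<and>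
    ev_tail (strand D j ! l) \<and> ev_id (strand D j ! l) = ev_id (strand D i ! k)"
  then show "y = (i, k)"
    using wf_gd_unique[OF assms(1), of "fst y" "snd y" i k] assms
        by (auto simp: case_prod_beta prod_eq_iff)
qed (use assms in auto)

text \<open>Each iteration makes the colours correct in one more degree.\<close>
fun chen :: "gdiag \<Rightarrow> nat \<Rightarrow> nat \<Rightarrow> nat word" where
  "chen D 0 c = []"
| "chen D (Suc t) c = (case tail_pos D c of (i, k) \<Rightarrow>
     conj_gen i (under_word (chen D t) (take k (strand D i))))"

text \<open>If the colours are stable below degree \<open>t\<close>, so are the conjugators built
  from them. In the conjugate of 1 + X_i the letter X_i itself uses up one degree, which gives
  stability below degree \<open>t + 1\<close>.\<close>

lemma chen_stable: "magnus_eq n (nonrep t) (chen D t c) (chen D (Suc t) c)"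
proof (induction t arbitrary: c)
  case 0
  then show ?case by (simp add: magnus_eq_def nonrep_def)
next
  case (Suc t)
  obtain i k where "tail_pos D c = (i, k)" by fastforce
  moreover have "magnus_eq n (nonrep (Suc t)) (conj_gen i (under_word (chen D t) (take k
      (strand D i))))
      (conj_gen i (under_word (chen D (Suc t)) (take k (strand D i))))"
    by (rule conj_gen_cong[OF factor_closed_nonrep under_word_cong[OF factor_closed_nonrep Suc]])
      (auto simp: nonrep_def)
  ultimately show ?case by simp
qed

text \<open>Below degree \<open>q\<close> the iterate \<open>chen D q\<close> agrees with the next
  one, and that one is by construction the required conjugate.\<close>

lemma colouring_exists:
  assumes "wf_gd m D"
  shows "colouring n q D (chen D q)"
  unfolding colouring_def
proof (intro allI impI)
  fix i k assume "1 \<le> i" "i \<le> length D" "k < length (strand D i)" "ev_tail (strand D i ! k)"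
  then show "magnus_eq n (nonrep q) (chen D q (ev_id (strand D i ! k)))
      (conj_gen i (under_word (chen D q) (take k (strand D i))))"
    using chen_stable[of n q D "ev_id (strand D i ! k)"] tail_pos_eq[OF assms] by simp
qed

section \<open>Moves that insert crossings\<close>

lemma colouringD:
  assumes "colouring n q D U" "1 \<le> i" "i \<le> length D" "strand D i = xs @ e # ys" "ev_tail e"
  shows "magnus_eq n (nonrep q) (U (ev_id e)) (conj_gen i (under_word U xs))"
  using assms(1)[unfolded colouring_def, rule_format, of i "length xs"] assms(2-) by simp

lemma colouringI:
  assumes "\<And>i xs e ys. 1 \<le> i \<Longrightarrow> i \<le> length D \<Longrightarrow> strand D i = xs @ e # ys \<Longrightarrow> ev_tail e \<Longrightarrow>
    magnus_eq n (nonrep q) (U (ev_id e)) (conj_gen i (under_word U xs))"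
  shows "colouring n q D U"
  unfolding colouring_def using assms id_take_nth_drop by blast

lemma under_word_tails: "\<forall>e\<in>set L. ev_tail e \<Longrightarrow> under_word U L = []"
  by (auto simp: under_word_def)

text \<open>No undercrossing separates consecutive tails: they lie on one arc and share its
  colour.\<close>

lemma colouring_tail_block:
  assumes "colouring n q D U" "1 \<le> i" "i \<le> length D" "strand D i = xs @ L @ ys"
    "\<forall>e\<in>set L. ev_tail e" "e \<in> set L"
  shows "magnus_eq n (nonrep q) (U (ev_id e)) (conj_gen i (under_word U xs))"
proof -
  obtain L1 L2 where L: "L = L1 @ e # L2" using assms(6) by (meson split_list)
  have "under_word U L1 = []"
    using assms(5) unfolding L by (intro under_word_tails) simp
  then show ?thesis
    using colouringD[OF assms(1-3), of "xs @ L1" e "L2 @ ys"] assms(4-6) L by simp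
qed

lemma length_ins [simp]: "length (ins D i p L) = length D"
  by (simp add: ins_def)

lemma strand_ins:
  assumes "valid_pos D i p" "1 \<le> k"
  shows "strand (ins D i p L) k =
    (if k = i then take p (strand D i) @ L @ drop p (strand D i) else strand D k)"
  using assms by (auto simp: ins_def strand_def valid_pos_def nth_list_update)

definition same_longitudes ::
  "nat \<Rightarrow> nat \<Rightarrow> gdiag \<Rightarrow> (nat \<Rightarrow> nat word) \<Rightarrow> gdiag \<Rightarrow> (nat \<Rightarrow> nat word) \<Rightarrow> bool" where
  "same_longitudes n q D U D' U' \<longleftrightarrow> (\<forall>i. 1 \<le> i \<longrightarrow> i \<le> length D \<longrightarrow>
     magnus_eq n (nonrep_off q i) (under_word U (strand D i)) (under_word U' (strand D' i)))"

text \<open>Colours on strand \<open>i\<close> depend on the conjugator only modulo X_i, where the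
  block is trivial; the other strands keep their words. Passing from the larger diagram to the
  smaller one avoids having to find colours for the inserted crossings.\<close>

lemma colouring_remove_block:
  assumes col: "colouring n q (ins D i p L) U" and v: "valid_pos D i p"
    and L: "magnus_eq n (nonrep_off q i) (under_word U L) []"
  shows "colouring n q D U" and "same_longitudes n q D U (ins D i p L) U"
proof -
  let ?s = "strand D i"
  note F = factor_closed_nonrep_off
  have s': "strand (ins D i p L) i = take p ?s @ L @ drop p ?s"
    using v by (simp add: strand_ins valid_pos_def)
  have drop_L: "magnus_eq n (nonrep_off q i) (under_word U xs @ under_word U L @ under_word U ys)
      (under_word U xs @ under_word U ys)" for xs ys
    by (rule magnus_eq_cancel_mid[OF F L])
  show "colouring n q D U"
  proof (rule colouringI)
    fix k xs e ys
    assume k: "1 \<le> k" "k \<le> length D" and s: "strand D k = xs @ e # ys" and e: "ev_tail e"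
    show "magnus_eq n (nonrep q) (U (ev_id e)) (conj_gen k (under_word U xs))"
    proof (cases "k = i")
      case False
      then show ?thesis using colouringD[OF col k(1) _ _ e, of xs ys] k s v
          by (simp add: strand_ins)
    next
      case True
      have "take p ?s @ drop p ?s = xs @ e # ys" unfolding append_take_drop_id using s True by simp
      \<comment> \<open>The tail \<open>e\<close> lies before the insertion point, where its prefix
        is unchanged, or after it, where the prefix in the larger diagram also contains
        \<open>L\<close>.\<close>
      then consider zs where "take p ?s = xs @ e # zs" | zs
          where "xs = take p ?s @ zs" "drop p ?s = zs @ e # ys"
        unfolding append_eq_append_conv2 Cons_eq_append_conv append_eq_Cons_conv by auto
      then show ?thesis
      proof cases
        case 1
        then show ?thesis
          using colouringD[OF col k(1) _ _ e, of xs "zs @ L @ drop p ?s"] k True s' by simp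
      next
        case 2
        have "magnus_eq n (nonrep q) (U (ev_id e)) (conj_gen i (under_word U (take p ?s @ L @ zs)))"
          using colouringD[OF col k(1) _ _ e, of "take p ?s @ L @ zs" ys] k True s' 2 by simp
        also have "magnus_eq n (nonrep q) \<dots> (conj_gen i (under_word U xs))"
          using drop_L[of "take p ?s" zs] 2(1) by (intro conj_gen_cong_off) simp
        finally show ?thesis using True by simp
      qed
    qed
  qed
  show "same_longitudes n q D U (ins D i p L) U"
    unfolding same_longitudes_def
  proof (intro allI impI)
    fix k assume "1 \<le> k" "k \<le> length D"
    have "under_word U (take p ?s) @ under_word U (drop p ?s) = under_word U ?s"
      unfolding under_word_append[symmetric] by simp
    then show "magnus_eq n (nonrep_off q k) (under_word U (strand D k)) (under_word U (strand
        (ins D i p L) k))"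
      using drop_L[of "take p ?s" "drop p ?s"] \<open>1 \<le> k\<close> v
      by (auto simp: strand_ins intro: magnus_eq_sym)
  qed
qed

lemma same_longitudes_trans:
  "same_longitudes n q D U D' U' \<Longrightarrow> same_longitudes n q D' U' D'' U'' \<Longrightarrow> length D = length D' \<Longrightarrow>
    same_longitudes n q D U D'' U''"
  unfolding same_longitudes_def by (metis magnus_eq_trans)

text \<open>The side condition of \<open>ins2\<close> keeps the second insertion from splitting the
  first block, so both blocks survive as contiguous segments even on a common strand.\<close>

lemma ins2_blocks:
  assumes "ins2 D i p L1 j r L2 D'"
  obtains xs ys zs ws where "1 \<le> i" "i \<le> length D'" "1 \<le> j" "j \<le> length D'"
    "strand D' i = xs @ L1 @ ys" "strand D' j = zs @ L2 @ ws"
proof -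
  let ?E = "ins D i p L1"
  have a: "valid_pos D i p" "valid_pos ?E j r" "D' = ins ?E j r L2"
    "j \<noteq> i \<or> r \<le> p \<or> p + length L1 \<le> r"
    using assms by (auto simp: ins2_def)
  have ij: "1 \<le> i" "i \<le> length D'" "1 \<le> j" "j \<le> length D'" using a by (auto simp: valid_pos_def)
  have E: "strand ?E i = take p (strand D i) @ L1 @ drop p (strand D i)"
    using a ij by (simp add: strand_ins)
  have p: "p \<le> length (strand D i)" using a by (simp add: valid_pos_def)
  have "\<exists>xs ys. strand D' i = xs @ L1 @ ys"
  proof (cases "j = i")
    case False
    then show ?thesis using a ij E by (auto simp: strand_ins)
  next
    case True
    then have D': "strand D' i = take r (strand ?E i) @ L2 @ drop r (strand ?E i)"
      using a ij by (simp add: strand_ins)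
    from a(4) True consider "r \<le> p" | "p + length L1 \<le> r" by auto
    then show ?thesis
    proof cases
      case 1
      then have "drop r (strand ?E i) = drop r (take p (strand D i)) @ L1 @ drop p (strand D i)"
        using p by (simp add: E)
      then show ?thesis using D' by (metis append.assoc)
    next
      case 2
      then have "take r (strand ?E i)
          = take p (strand D i) @ L1 @ take (r - p - length L1) (drop p (strand D i))"
        using p unfolding E by (cases "r = p") (auto simp: min_def)
      then show ?thesis using D' by (metis append.assoc)
    qed
  qed
  moreover have "\<exists>zs ws. strand D' j = zs @ L2 @ ws"
    using strand_ins[OF a(2) ij(3), of L2] a(3) by auto
  ultimately show thesis using that ij by blast
qed

lemma colouring_remove_blocks:
  assumes col: "colouring n q D' U" and ins: "ins2 D i p L1 j r L2 D'"
    and L1: "magnus_eq n (nonrep_off q i) (under_word U L1) []"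
    and L2: "magnus_eq n (nonrep_off q j) (under_word U L2) []"
  shows "colouring n q D U \<and> same_longitudes n q D U D' U"
proof -
  let ?E = "ins D i p L1"
  have a: "valid_pos D i p" "valid_pos ?E j r" "D' = ins ?E j r L2"
    using ins by (auto simp: ins2_def)
  \<comment> \<open>The blocks are removed in the reverse order of their insertion.\<close>
  note E = colouring_remove_block[OF col[unfolded a(3)] a(2) L2]
  show ?thesis
    using colouring_remove_block[OF E(1) a(1) L1] E(2) same_longitudes_trans a(3) by fastforce
qed

text \<open>The property established for every move. Since any colouring computes the invariants,
  one pair of colourings with matching longitudes is enough.\<close>

definition matched :: "nat \<Rightarrow> nat \<Rightarrow> gdiag \<Rightarrow> gdiag \<Rightarrow> bool" where
  "matched n q D D' \<longleftrightarrow> (\<exists>U U'. colouring n q D U \<and> colouring n q D' U' \<and>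
      same_longitudes n q D U D' U')"

lemma ev_simps [simp]: "ev_id (c, t, s) = c" "ev_tail (c, t, s) = t" "ev_pos (c, t, s) = s"
  by (simp_all add: ev_id_def ev_tail_def ev_pos_def)

text \<open>The \<open>n\<close> tails lie on one arc with colour \<open>g\<close>, so the
  \<open>n\<close> heads contribute the \<open>n\<close>-th power of \<open>g\<close> or of its
  inverse, which is trivial. Both blocks can then be removed.\<close>

lemma matched_Vn_move:
  assumes col: "colouring n q D' U" and move: "Vn_move n D D'"
  shows "matched n q D D'"
proof -
  from move obtain cs s i p j r T where cs: "length cs = n"
    and T: "T = map (\<lambda>c. (c, True, s)) cs \<or> T = rev (map (\<lambda>c. (c, True, s)) cs)"
    and ins: "ins2 D i p T j r (map (\<lambda>c. (c, False, s)) cs) D'"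
    unfolding Vn_move_def by blast
  from ins obtain xs ys where i: "1 \<le> i" "i \<le> length D'" "strand D' i = xs @ T @ ys"
    by (rule ins2_blocks)
  have T_tail: "\<forall>e\<in>set T. ev_tail e" and T_set: "set T = (\<lambda>c. (c, True, s)) ` set cs" using T
      by auto
  define g where "g = conj_gen i (under_word U xs)"
  have U: "magnus_eq n (nonrep q) (U c) g" if "c \<in> set cs" for c
    using colouring_tail_block[OF col i T_tail, of "(c, True, s)"] that T_set by (simp add: g_def)
  have "magnus_eq n (nonrep q) (under_word U (map (\<lambda>c. (c, False, s)) ds)) (word_pow (signed s g)
      (length ds))"
    if "set ds \<subseteq> set cs" for ds
    using that
    by (induction ds) (auto simp: under_word_Cons U
        intro!: magnus_eq_append factor_closed_nonrep magnus_eq_signed)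
  from this[of cs] have "magnus_eq n (nonrep q) (under_word U (map (\<lambda>c. (c, False, s)) cs))
      (word_pow (signed s g) n)"
    by (simp add: cs)
  also have "magnus_eq n (nonrep q) \<dots> []"
    by (rule conj_gen_pow_trivial[of _ _ _ i "under_word U xs"]) (simp add: g_def)
  finally have "magnus_eq n (nonrep_off q j) (under_word U (map (\<lambda>c. (c, False, s)) cs)) []"
    by (rule magnus_eq_mono[OF _ nonrep_off_subset])
  from colouring_remove_blocks[OF col ins _ this] col show ?thesis
    unfolding matched_def by (auto simp: under_word_tails[OF T_tail])
qed

text \<open>The two tails lie on one arc, so the heads, having opposite signs, contribute a colour
  and its inverse in one of the two orders.\<close>

lemma matched_R2:
  assumes col: "colouring n q D' U" and move: "R2 D D'"
  shows "matched n q D D'"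
proof -
  from move obtain i p j r a b s L2 where
    L2: "L2 = [(a, False, s), (b, False, \<not> s)] \<or> L2 = [(b, False, \<not> s), (a, False, s)]"
    and ins: "ins2 D i p [(a, True, s), (b, True, \<not> s)] j r L2 D'"
    unfolding R2_def by blast
  let ?T = "[(a, True, s), (b, True, \<not> s)]"
  from ins obtain xs ys where i: "1 \<le> i" "i \<le> length D'" "strand D' i = xs @ ?T @ ys"
    by (rule ins2_blocks)
  define g where "g = conj_gen i (under_word U xs)"
  have U: "magnus_eq n (nonrep q) (U a) g" "magnus_eq n (nonrep q) (U b) g"
    using colouring_tail_block[OF col i, of "(a, True, s)"]
        colouring_tail_block[OF col i, of "(b, True, \<not> s)"]
    by (simp_all add: g_def)
  note F = factor_closed_nonrep
  have "magnus_eq n (nonrep q) (signed s (U a) @ signed (\<not> s) (U b)) (signed s g @ winv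
      (signed s g))"
    "magnus_eq n (nonrep q) (signed (\<not> s) (U b) @ signed s (U a)) (winv (signed s g) @ signed s g)"
    by (simp_all add: winv_signed magnus_eq_append F magnus_eq_signed U)
  then have "magnus_eq n (nonrep q) (under_word U L2) []"
    using L2 magnus_eq_left_inverse[OF F] magnus_eq_right_inverse[OF F] magnus_eq_trans
    by (auto simp: under_word_Cons)
  then have "magnus_eq n (nonrep_off q j) (under_word U L2) []"
    by (rule magnus_eq_mono[OF _ nonrep_off_subset])
  from colouring_remove_blocks[OF col ins _ this] col show ?thesis
    unfolding matched_def by (auto simp: under_word_Cons)
qed

lemma signed_trivial_off:
  assumes "magnus_eq n (nonrep q) u (conj_gen i w)"
  shows "magnus_eq n (nonrep_off q i) (signed b u) []"
proof -
  note F = factor_closed_nonrep_off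
  have u: "magnus_eq n (nonrep_off q i) u []"
    using magnus_eq_mono[OF assms nonrep_off_subset] conj_gen_trivial_off magnus_eq_trans by blast
  then show ?thesis using magnus_eq_winv[OF F u] by (simp add: signed_def)
qed

text \<open>The over-arc of a self-crossing belongs to strand \<open>i\<close> itself, so its colour
  is a conjugate of 1 + X_i and vanishes modulo X_i. Each endpoint is thus a removable
  block.\<close>

lemma matched_sv_move:
  assumes col: "colouring n q D' U" and move: "sv_move D D'"
  shows "matched n q D D'"
proof -
  from move obtain c t s i p r where ins: "ins2 D i p [(c, t, s)] i r [(c, \<not> t, s)] D'"
    unfolding sv_move_def by blast
  from ins obtain xs ys zs ws where i: "1 \<le> i" "i \<le> length D'"
    "strand D' i = xs @ [(c, t, s)] @ ys" "strand D' i = zs @ [(c, \<not> t, s)] @ ws"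
    by (rule ins2_blocks)
  \<comment> \<open>Either of the two inserted events may be the tail.\<close>
  have "\<exists>xs' ys'. strand D' i = xs' @ [(c, True, s)] @ ys'"
  proof (cases t)
    case True
    then show ?thesis using i(3) by auto
  next
    case False
    then show ?thesis using i(4) by auto
  qed
  then obtain xs' ys' where "strand D' i = xs' @ [(c, True, s)] @ ys'" by blast
  from colouring_tail_block[OF col i(1,2) this, of "(c, True, s)"]
  have "magnus_eq n (nonrep q) (U c) (conj_gen i (under_word U xs'))" by simp
  then have "magnus_eq n (nonrep_off q i) (signed s (U c)) []"
    by (rule signed_trivial_off)
  then have "magnus_eq n (nonrep_off q i) (under_word U [(c, b, s)]) []" for b
    by (simp add: under_word_Cons)
  from colouring_remove_blocks[OF col ins this this] col show ?thesis
    unfolding matched_def by blast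
qed

text \<open>A kink is a self-crossing with adjacent endpoints, so R1 is a special case of
  self-crossing virtualization.\<close>

lemma matched_R1:
  assumes col: "colouring n q D' U" and move: "R1 D D'"
  shows "matched n q D D'"
proof (rule matched_sv_move[OF col])
  from move obtain i p c t s where v: "valid_pos D i p" and "fresh D c"
    and D': "D' = ins D i p [(c, t, s), (c, \<not> t, s)]"
    unfolding R1_def by blast
  \<comment> \<open>Position \<open>Suc p\<close> puts the second endpoint directly after the
    first.\<close>
  moreover have "ins2 D i p [(c, t, s)] i (Suc p) [(c, \<not> t, s)] D'"
  proof -
    have *: "strand (ins D i p [(c, t, s)]) i
        = take p (strand D i) @ (c, t, s) # drop p (strand D i)"
      using v by (simp add: strand_ins valid_pos_def)
    have "ins (ins D i p [(c, t, s)]) i (Suc p) [(c, \<not> t, s)] = D'"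
      unfolding ins_def[of "ins _ _ _ _"] * using v
      by (simp add: ins_def D' valid_pos_def min_def)
    then show ?thesis using v * by (auto simp: ins2_def valid_pos_def)
  qed
  ultimately show "sv_move D D'" unfolding sv_move_def by blast
qed

section \<open>Moves that permute crossings\<close>

lemma length_swp [simp]: "length (swp D i p) = length D"
  by (simp add: swp_def)

lemma length_strand_swp [simp]: "length (strand (swp D i p) j) = length (strand D j)"
  by (cases "i - 1 < length D")
    (auto simp: swp_def strand_def nth_list_update list_update_beyond)

lemma nth_strand_swp:
  assumes "valid_pair D i p" "1 \<le> j" "k < length (strand D j)"
  shows "strand (swp D i p) j ! k =
    (if j = i \<and> k = p then strand D i ! Suc p else if j = i \<and> k = Suc p then strand D i ! p
     else strand D j ! k)"
  using assms by (auto simp: swp_def strand_def valid_pair_def nth_list_update)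

lemma valid_pair_swp [simp]: "valid_pair (swp D i p) j k = valid_pair D j k"
  by (simp add: valid_pair_def)

lemma under_word_take_Suc:
  "k < length xs \<Longrightarrow> under_word U (take (Suc k) xs)
      = under_word U (take k xs) @ under_word U [xs ! k]"
  by (simp add: take_Suc_conv_app_nth)

lemma under_word_local_change:
  assumes P: "factor_closed P" and len: "length xs = length ys"
    and same: "\<And>k. k < length xs \<Longrightarrow> k \<notin> B \<Longrightarrow> k \<notin> Suc ` B \<Longrightarrow> under_word U [xs ! k]
        = under_word U' [ys ! k]"
    and pair: "\<And>p. p \<in> B \<Longrightarrow> Suc p < length xs \<and> Suc p \<notin> B \<and>
        magnus_eq n P (under_word U [xs ! p, xs ! Suc p]) (under_word U' [ys ! p, ys ! Suc p])"
    and k: "k \<le> length xs" "k \<notin> Suc ` B"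
  shows "magnus_eq n P (under_word U (take k xs)) (under_word U' (take k ys))"
  using k
\<comment> \<open>Complete induction is needed because a pair is crossed in one step of length
  two.\<close>
proof (induction k rule: less_induct)
  case (less k)
  show ?case
  proof (cases k)
    case (Suc k')
    then have k': "k' < length xs" "k' \<notin> B" using less.prems by auto
    show ?thesis
    proof (cases "k' \<in> Suc ` B")
      case False
      then have "magnus_eq n P (under_word U (take k' xs)) (under_word U' (take k' ys))"
        using less.IH[of k'] Suc k' by simp
      then show ?thesis
        using same[OF k' False] k' len Suc
        by (simp add: under_word_take_Suc magnus_eq_append[OF P])
    next
      case True
      then obtain p where p: "p \<in> B" "k' = Suc p" by blast
      have "p \<notin> Suc ` B" using pair p by blast
      then have "magnus_eq n P (under_word U (take p xs)) (under_word U' (take p ys))"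
        using less.IH[of p] Suc p k' by simp
      from magnus_eq_append[OF P this, of "under_word U [xs ! p, xs ! Suc p]"
          "under_word U' [ys ! p, ys ! Suc p]"]
      have "magnus_eq n P (under_word U
          (take p xs) @ under_word U [xs ! p] @ under_word U [xs ! Suc p])
          (under_word U' (take p ys) @ under_word U' [ys ! p] @ under_word U' [ys ! Suc p])"
        using pair[OF p(1)] by (simp add: under_word_Cons)
      then show ?thesis
        using p k' len Suc by (simp add: under_word_take_Suc)
    qed
  qed simp
qed

text \<open>Adjacent tails lie on the same arc and contribute nothing to the conjugators, so the
  colouring \<open>U\<close> also fits the swapped diagram.\<close>

lemma matched_OC:
  assumes col: "colouring n q D U" and move: "OC D D'"
  shows "matched n q D D'"
proof -
  from move obtain i p where v: "valid_pair D i p"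
      and t: "ev_tail (strand D i ! p)" "ev_tail (strand D i ! Suc p)"
    and D': "D' = swp D i p"
    unfolding OC_def by auto
  have pre: "magnus_eq n P (under_word U (take k (strand D j))) (under_word U (take k
      (strand D' j)))"
    if "k \<le> length (strand D j)" "1 \<le> j" "factor_closed P" for j k P
    using that t v
    by (intro under_word_local_change[where B =
        "{}"]) (auto simp: D' nth_strand_swp under_word_Cons)
  have "same_longitudes n q D U D' U"
    unfolding same_longitudes_def using pre[OF order.refl _ factor_closed_nonrep_off]
        by (simp add: D')
  moreover have "colouring n q D' U"
    unfolding colouring_def
  proof (intro allI impI)
    fix j k assume j: "1 \<le> j" "j \<le> length D'" and k: "k < length (strand D' j)"
        and tl: "ev_tail (strand D' j ! k)"
    \<comment> \<open>The position that the event at \<open>k\<close> had before the swap.\<close>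
    define k' where "k' = (if j = i \<and> k = p then Suc p else if j = i \<and> k = Suc p then p else k)"
    have k': "k' < length (strand D j)" and e: "strand D' j ! k = strand D j ! k'"
      using j k v by (auto simp: k'_def D' nth_strand_swp valid_pair_def)
    have "under_word U (take k' (strand D j)) = under_word U (take k (strand D j))"
      using k v t by (auto simp: k'_def D' valid_pair_def under_word_take_Suc under_word_Cons)
    then have "magnus_eq n (nonrep q) (U (ev_id (strand D' j ! k))) (conj_gen j (under_word U
        (take k (strand D j))))"
      using col[unfolded colouring_def, rule_format, of j k'] j k' tl e by (simp add: D')
    also have "magnus_eq n (nonrep q) \<dots> (conj_gen j (under_word U (take k (strand D' j))))"
      by (rule conj_gen_cong_off, rule pre[OF _ _ factor_closed_nonrep_off])
          (use j k in \<open>auto simp: D'\<close>)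
    finally show "magnus_eq n (nonrep q) (U (ev_id (strand D' j ! k))) (conj_gen j (under_word U
        (take k (strand D' j))))" .
  qed
  ultimately show ?thesis using col unfolding matched_def by blast
qed

lemma matched_rename:
  assumes col: "colouring n q D U" and move: "rename D D'"
  shows "matched n q D D'"
proof -
  from move obtain f where f: "inj f" and D': "D' = map (map (\<lambda>(c, t, s). (f c, t, s))) D"
    unfolding rename_def by blast
  define r where "r = (\<lambda>(c, t, s). (f c, t, s) :: ev)"
  define U' where "U' = U \<circ> inv f"
  have r [simp]: "ev_tail (r e) = ev_tail e" "ev_pos (r e) = ev_pos e"
      "ev_id (r e) = f (ev_id e)" for e
    by (cases e; simp add: r_def)+
  have U' [simp]: "U' (f c) = U c" for c using f by (simp add: U'_def)
  have W: "under_word U' (map r xs) = under_word U xs" for xs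
    by (induction xs) (auto simp: under_word_Cons)
  have s: "strand D' i = map r (strand D i)" if "1 \<le> i" "i \<le> length D" for i
    using that by (simp add: strand_def D' r_def)
  have len: "length D' = length D" by (simp add: D')
  have "colouring n q D' U'"
    using col unfolding colouring_def by (auto simp: s len W take_map)
  moreover have "same_longitudes n q D U D' U'"
    by (simp add: same_longitudes_def s W)
  ultimately show ?thesis using col unfolding matched_def by blast
qed

section \<open>The third Reidemeister move\<close>

lemma magnus_eq_transpose:
  assumes P: "factor_closed P" and e: "magnus_eq n P (a @ b) (c @ d)"
  shows "magnus_eq n P (winv c @ a) (d @ winv b)"
proof -
  have "magnus_eq n P (winv c @ a) (winv c @ a @ b @ winv b)"
    using magnus_eq_cancel_mid[OF P magnus_eq_right_inverse[OF P], of n "winv c @ a" b "[]"]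
    by (simp add: magnus_eq_sym)
  also have "magnus_eq n P (winv c @ a @ b @ winv b) (winv c @ c @ d @ winv b)"
    using magnus_eq_append[OF P magnus_eq_refl[of n P "winv c"]
        magnus_eq_append[OF P e magnus_eq_refl[of n P "winv b"]]]
    by simp
  also have "magnus_eq n P \<dots> (d @ winv b)"
    using magnus_eq_cancel_mid[OF P magnus_eq_left_inverse[OF P], of n "[]" c "d @ winv b"] by simp
  finally show ?thesis .
qed

text \<open>If \<open>z\<close> intertwines \<open>x\<close> and \<open>y\<close>, it intertwines
  their inverses, and the inverse of \<open>z\<close> does so in the other direction. This covers
  all sign patterns of R3.\<close>

lemma magnus_eq_intertwine:
  assumes P: "factor_closed P" and e: "magnus_eq n P (z @ x) (y @ z)"
  shows "magnus_eq n P (z @ signed s x) (signed s y @ z)"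
    and "magnus_eq n P (winv z @ signed s y) (signed s x @ winv z)"
proof -
  show 1: "magnus_eq n P (z @ signed s x) (signed s y @ z)"
    using e magnus_eq_sym[OF magnus_eq_transpose[OF P e]] by (simp add: signed_def)
  show "magnus_eq n P (winv z @ signed s y) (signed s x @ winv z)"
    by (rule magnus_eq_transpose[OF P magnus_eq_sym[OF 1]])
qed

text \<open>The Wirtinger relation at an undercrossing with signed over-colour \<open>z\<close>, in
  the form consumed by \<open>magnus_eq_intertwine\<close>.\<close>

lemma conj_gen_intertwine:
  assumes P: "factor_closed P"
  shows "magnus_eq n P (z @ conj_gen i (w @ z)) (conj_gen i w @ z)"
  using magnus_eq_cancel_mid[OF P magnus_eq_right_inverse[OF P], of n "[]" z "conj_gen i w @ z"]
  by (simp add: conj_gen_def)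

text \<open>Only the colour at \<open>c\<close> changes, because its tail moves across the head of
  \<open>a\<close> on the middle segment. On the bottom segment the heads of \<open>b\<close> and
  \<open>c\<close> trade places; their products agree because \<open>a\<close> and \<open>b\<close>
  have the same colour, which intertwines the old and new colours of \<open>c\<close>.\<close>

lemma matched_R3:
  assumes wf: "wf_gd m D" and col: "colouring n q D U" and move: "R3 D D'"
  shows "matched n q D D'"
proof -
  from move obtain a b c sa sb sc iT pT iM pM iB pB oT oM oB where
    dist: "a \<noteq> b" "a \<noteq> c" "b \<noteq> c"
    and v: "valid_pair D iT pT" "valid_pair D iM pM" "valid_pair D iB pB"
    and disj: "loc_disj (iT, pT) (iM, pM)" "loc_disj (iT, pT) (iB, pB)" "loc_disj (iM, pM) (iB, pB)"
    and pT: "pair_at D iT pT = (if oT then ((a, True, sa), (b, True, sb)) else ((b, True, sb),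
        (a, True, sa)))"
    and pM: "pair_at D iM pM = (if oM then ((a, False, sa), (c, True, sc)) else ((c, True, sc),
        (a, False, sa)))"
    and pB: "pair_at D iB pB = (if oB then ((b, False, sb), (c, False, sc)) else ((c, False, sc),
        (b, False, sb)))"
    and sgn: "sgn_of sa * sgn_of oT * sgn_of oM = sgn_of sb * sgn_of oT * sgn_of oB"
    and D': "D' = swp (swp (swp D iT pT) iM pM) iB pB"
    unfolding R3_def by blast
  let ?P = "nonrep q"
  note F = factor_closed_nonrep
  \<comment> \<open>Cancelling the factor for \<open>oT\<close> in the sign condition compares the
    signs of \<open>a\<close> and \<open>b\<close> through the orders on the middle and bottom
    segments.\<close>
  have sb: "sb = (if oM = oB then sa else \<not> sa)"
    using sgn by (auto simp: sgn_of_def split: if_splits)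
  have T: "strand D iT ! pT = (if oT then (a, True, sa) else (b, True, sb))"
    "strand D iT ! Suc pT = (if oT then (b, True, sb) else (a, True, sa))"
    using pT by (auto simp: pair_at_def)
  have M: "strand D iM ! pM = (if oM then (a, False, sa) else (c, True, sc))"
    "strand D iM ! Suc pM = (if oM then (c, True, sc) else (a, False, sa))"
    using pM by (auto simp: pair_at_def)
  have B: "strand D iB ! pB = (if oB then (b, False, sb) else (c, False, sc))"
    "strand D iB ! Suc pB = (if oB then (c, False, sc) else (b, False, sb))"
    using pB by (auto simp: pair_at_def)
  have rng: "1 \<le> iT" "iT \<le> length D" "Suc pT < length (strand D iT)"
    "1 \<le> iM" "iM \<le> length D" "Suc pM < length (strand D iM)"
    "1 \<le> iB" "iB \<le> length D" "Suc pB < length (strand D iB)"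
    using v by (auto simp: valid_pair_def)
  have len: "length D' = length D" "length (strand D' j) = length (strand D j)" for j
    by (simp_all add: D')
  have sep: "\<not> (iM = iT \<and> (pM = pT \<or> pM = Suc pT))" "\<not> (iM = iT \<and> (Suc pM = pT \<or> Suc pM = Suc pT))"
    "\<not> (iB = iT \<and> (pB = pT \<or> pB = Suc pT))" "\<not> (iB = iT \<and> (Suc pB = pT \<or> Suc pB = Suc pT))"
    "\<not> (iB = iM \<and> (pB = pM \<or> pB = Suc pM))" "\<not> (iB = iM \<and> (Suc pB = pM \<or> Suc pB = Suc pM))"
    using disj by (auto simp: loc_disj_def)
  \<comment> \<open>Since the segments are disjoint, the three swaps do not interfere and can be
    read off separately.\<close>
  have nth: "strand D' j ! k =
     (if j = iB \<and> k = pB then strand D iB ! Suc pB else if j = iB \<and> k = Suc pB then strand D iB ! pB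
      else if j = iM \<and> k = pM then strand D iM ! Suc pM else if j = iM \<and> k
          = Suc pM then strand D iM ! pM
      else if j = iT \<and> k = pT then strand D iT ! Suc pT else if j = iT \<and> k
          = Suc pT then strand D iT ! pT
      else strand D j ! k)" if j: "1 \<le> j" "k < length (strand D j)" for j k
  proof -
    let ?D1 = "swp D iT pT" and ?D2 = "swp (swp D iT pT) iM pM"
    note n1 = nth_strand_swp[OF v(1)]
    have v': "valid_pair ?D1 iM pM" "valid_pair ?D2 iB pB" using v by simp_all
    note n2 = nth_strand_swp[OF v'(1)] and n3 = nth_strand_swp[OF v'(2)]
    have M1: "strand ?D1 iM ! pM = strand D iM ! pM" "strand ?D1 iM ! Suc pM = strand D iM ! Suc pM"
      using n1[of iM pM] n1[of iM "Suc pM"] sep(1,2) rng(4-6)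
          by (simp_all only: simp_thms if_False) auto
    have B1: "strand ?D1 iB ! pB = strand D iB ! pB" "strand ?D1 iB ! Suc pB = strand D iB ! Suc pB"
      using n1[of iB pB] n1[of iB "Suc pB"] sep(3,4) rng(7-9)
          by (simp_all only: simp_thms if_False) auto
    have B2: "strand ?D2 iB ! pB = strand D iB ! pB" "strand ?D2 iB ! Suc pB = strand D iB ! Suc pB"
      using n2[of iB pB] n2[of iB "Suc pB"] sep(5,6) rng(7-9) B1
          by (simp_all only: simp_thms if_False) auto
    show ?thesis
      unfolding D' using n3[of j k] n2[of j k] n1[of j k] j
      by (simp only: length_strand_swp B2 M1 simp_thms)
  qed
  have nB: "strand D' iB ! pB = strand D iB ! Suc pB" "strand D' iB ! Suc pB = strand D iB ! pB"
    using nth[of iB pB] nth[of iB "Suc pB"] rng(7-9) by simp_all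
  have nM: "strand D' iM ! pM = strand D iM ! Suc pM" "strand D' iM ! Suc pM = strand D iM ! pM"
    using nth[of iM pM] nth[of iM "Suc pM"] rng(4-6) sep(5,6) by (simp_all split del: if_split) auto
  have nT: "strand D' iT ! pT = strand D iT ! Suc pT" "strand D' iT ! Suc pT = strand D iT ! pT"
    using nth[of iT pT] nth[of iT "Suc pT"] rng(1-3) sep(1-4) by (simp_all split del: if_split) auto
  have colD: "magnus_eq n ?P (U (ev_id (strand D j ! k))) (conj_gen j (under_word U (take k
      (strand D j))))"
    if "1 \<le> j" "j \<le> length D" "k < length (strand D j)" "ev_tail (strand D j ! k)" for j k
    using col that by (simp add: colouring_def)
  have preT: "under_word U (take (Suc pT) (strand D iT)) = under_word U (take pT (strand D iT))"
    using rng T by (simp add: under_word_take_Suc under_word_Cons)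
  have "magnus_eq n ?P (U a) (conj_gen iT (under_word U (take pT (strand D iT))))"
    "magnus_eq n ?P (U b) (conj_gen iT (under_word U (take pT (strand D iT))))"
    using colD[of iT pT] colD[of iT "Suc pT"] T rng preT by (cases oT; simp)+
  then have Uab: "magnus_eq n ?P (U a) (U b)" by (meson magnus_eq_sym magnus_eq_trans)
  define W where "W = under_word U (take pM (strand D iM))"
  define z where "z = signed sa (U a)"
  define zb where "zb = signed sa (U b)"
  \<comment> \<open>The colour at \<open>c\<close> after the move. If \<open>oM\<close> holds, the
    tail of \<open>c\<close> moves ahead of the head of \<open>a\<close> and loses the conjugation
    by \<open>z\<close>; otherwise it acquires it.\<close>
  define N where "N = (if oM then conj_gen iM W else conj_gen iM (W @ z))"
  define U' where "U' = U(c := N)"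
  have zzb: "magnus_eq n ?P z zb" unfolding z_def zb_def by (rule magnus_eq_signed[OF F Uab])
  have Uc: "magnus_eq n ?P (U c) (if oM then conj_gen iM (W @ z) else conj_gen iM W)"
    using colD[of iM pM] colD[of iM "Suc pM"] M rng
    by (cases oM) (simp_all add: W_def z_def under_word_take_Suc under_word_Cons)
  have com: "if oM then magnus_eq n ?P (zb @ U c) (N @ zb) else magnus_eq n ?P (zb @ N) (U c @ zb)"
  proof -
    have "if oM then magnus_eq n ?P (z @ U c) (N @ z) else magnus_eq n ?P (z @ N) (U c @ z)"
    proof (cases oM)
      case True
      have "magnus_eq n ?P (z @ U c) (z @ conj_gen iM (W @ z))"
        using Uc True by (simp add: magnus_eq_append[OF F])
      also have "magnus_eq n ?P \<dots> (conj_gen iM W @ z)" by (rule conj_gen_intertwine[OF F])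
      finally show ?thesis using True by (simp add: N_def)
    next
      case False
      have "magnus_eq n ?P (z @ conj_gen iM (W @ z)) (conj_gen iM W @ z)"
          by (rule conj_gen_intertwine[OF F])
      also have "magnus_eq n ?P \<dots> (U c @ z)"
        using Uc False by (intro magnus_eq_append[OF F]) (simp_all add: magnus_eq_sym)
      finally show ?thesis using False by (simp add: N_def)
    qed
    moreover have "magnus_eq n ?P (zb @ x) (z @ x)" "magnus_eq n ?P (x @ z) (x @ zb)" for x
      using zzb by (simp_all add: magnus_eq_append[OF F] magnus_eq_sym)
    ultimately show ?thesis by (metis magnus_eq_trans)
  qed
  have pairB: "magnus_eq n ?P (under_word U [strand D iB ! pB, strand D iB ! Suc pB])
      (under_word U' [strand D iB ! Suc pB, strand D iB ! pB])"
  proof -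
    \<comment> \<open>The four cases of \<open>oM\<close> and \<open>oB\<close> correspond to the
      four intertwining relations with \<open>zb\<close> or its inverse.\<close>
    have "signed sb (U b) = (if oM = oB then zb else winv zb)"
      by (simp add: sb zb_def winv_signed)
    moreover have "if oM then magnus_eq n ?P (zb @ signed sc (U c)) (signed sc N @ zb) \<and>
        magnus_eq n ?P (signed sc (U c) @ winv zb) (winv zb @ signed sc N)
      else magnus_eq n ?P (signed sc (U c) @ zb) (zb @ signed sc N) \<and>
        magnus_eq n ?P (winv zb @ signed sc (U c)) (signed sc N @ winv zb)"
      using com by (auto intro: magnus_eq_intertwine[OF F]
          magnus_eq_sym[OF magnus_eq_intertwine(1)[OF F]]
          magnus_eq_sym[OF magnus_eq_intertwine(2)[OF F]])
    ultimately show ?thesis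
      using B dist by (cases oM; cases oB) (simp_all add: under_word_Cons U'_def)
  qed
  \<comment> \<open>Left positions of the middle and bottom pairs on strand \<open>j\<close>. The
    top pair consists of tails and agrees event by event.\<close>
  define bad where "bad j = (if j = iM then {pM} else {}) \<union> (if j = iB then {pB} else {})" for j
  \<comment> \<open>\<open>U\<close> and \<open>U'\<close> differ only at \<open>c\<close>, whose
    endpoints lie on the middle and bottom segments, so the events elsewhere keep their
    colours.\<close>
  have head_c: "(j, k) \<in> {(iB, pB), (iB, Suc pB)}"
    if "1 \<le> j" "j \<le> length D" "k < length (strand D j)" "\<not> ev_tail (strand D j ! k)"
        "ev_id (strand D j ! k) = c" for j k
    using wf_gd_unique[OF wf that(1-3), of iB pB] wf_gd_unique[OF wf that(1-3), of iB "Suc pB"]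
        that(4,5) B rng
    by (cases oB) auto
  have tail_c: "(j, k) \<in> {(iM, pM), (iM, Suc pM)}"
    if "1 \<le> j" "j \<le> length D" "k < length (strand D j)" "ev_tail (strand D j ! k)"
        "ev_id (strand D j ! k) = c" for j k
    using wf_gd_unique[OF wf that(1-3), of iM pM] wf_gd_unique[OF wf that(1-3), of iM "Suc pM"]
        that(4,5) M rng
    by (cases oM) auto
  have pre: "magnus_eq n ?P (under_word U (take k (strand D j))) (under_word U' (take k
      (strand D' j)))"
    if j: "1 \<le> j" "j \<le> length D" and k: "k \<le> length (strand D j)" "k \<notin> Suc ` bad j" for j k
  proof (rule under_word_local_change[OF F _ _ _ k])
    show "length (strand D j) = length (strand D' j)" by (simp add: len)
    show "under_word U [strand D j ! l] = under_word U' [strand D' j ! l]"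
      if l: "l < length (strand D j)" "l \<notin> bad j" "l \<notin> Suc ` bad j" for l
    proof (cases "j = iT \<and> (l = pT \<or> l = Suc pT)")
      case True
      then show ?thesis using nT T by (auto simp: under_word_Cons)
    next
      case False
      then have e: "strand D' j ! l = strand D j ! l"
        using nth[OF j(1) l(1)] l(2,3) by (auto simp: bad_def)
      show ?thesis
      proof (cases "ev_tail (strand D j ! l)")
        case False
        have "ev_id (strand D j ! l) \<noteq> c"
          using head_c[OF j l(1) False] l(2,3) by (auto simp: bad_def)
        then show ?thesis by (simp add: e under_word_Cons U'_def)
      qed (simp add: e under_word_Cons)
    qed
    show "Suc p < length (strand D j) \<and> Suc p \<notin> bad j \<and>
        magnus_eq n ?P (under_word U [strand D j ! p, strand D j ! Suc p])
          (under_word U' [strand D' j ! p, strand D' j ! Suc p])" if p: "p \<in> bad j" for p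
    proof -
      from p consider "j = iM" "p = pM" | "j = iB" "p = pB" by (auto simp: bad_def split: if_splits)
      then show ?thesis
      proof cases
        case 1
        have "Suc p \<notin> bad j" using sep 1 by (auto simp: bad_def)
        moreover have "strand D' j ! p = strand D iM ! Suc pM"
            "strand D' j ! Suc p = strand D iM ! pM"
          using nM 1 by simp_all
        ultimately show ?thesis
          using 1 rng M dist by (auto simp: under_word_Cons U'_def)
      next
        case 2
        have "Suc p \<notin> bad j" using sep 2 by (auto simp: bad_def)
        moreover have "strand D' j ! p = strand D iB ! Suc pB"
            "strand D' j ! Suc p = strand D iB ! pB"
          using nB 2 by simp_all
        ultimately show ?thesis using 2 rng pairB by simp
      qed
    qed
  qed
  have conj_pre: "magnus_eq n ?P (conj_gen j (under_word U (take k (strand D j))))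
      (conj_gen j (under_word U' (take k (strand D' j))))"
    if "1 \<le> j" "j \<le> length D" "k \<le> length (strand D j)" "k \<notin> Suc ` bad j" for j k
    by (rule conj_gen_cong_off, rule magnus_eq_mono[OF pre[OF that] nonrep_off_subset])
  have "colouring n q D' U'"
    unfolding colouring_def len
  proof (intro allI impI)
    fix j k assume j: "1 \<le> j" "j \<le> length D" and k: "k < length (strand D j)"
        and t: "ev_tail (strand D' j ! k)"
    consider (M1) "j = iM" "k = pM" | (M2) "j = iM" "k = Suc pM" | (bot) "j = iB"
        "k = pB \<or> k = Suc pB"
      | (top) "j = iT" "k = pT \<or> k = Suc pT" | (other) "\<not> (j = iM \<and> (k = pM \<or> k = Suc pM))"
        "\<not> (j = iB \<and> (k = pB \<or> k = Suc pB))" "\<not> (j = iT \<and> (k = pT \<or> k = Suc pT))" by blast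
    then show "magnus_eq n ?P (U' (ev_id (strand D' j ! k))) (conj_gen j (under_word U' (take k
        (strand D' j))))"
    proof cases
      case M1
      have e: "strand D' j ! k = strand D iM ! Suc pM" using nM M1 by simp
      then have oM: oM using t M by (auto split: if_splits)
      have "k \<notin> Suc ` bad j" using M1 sep by (auto simp: bad_def)
      from conj_pre[OF j _ this] show ?thesis
        using M1 k oM e M by (simp add: U'_def N_def W_def)
    next
      case M2
      have e: "strand D' j ! k = strand D iM ! pM" using nM M2 by simp
      then have oM: "\<not> oM" using t M by (auto split: if_splits)
      have e': "strand D' j ! pM = (a, False, sa)"
        using nM M2 oM M by simp
      \<comment> \<open>The prefix of length \<open>Suc pM\<close> ends inside a pair, where
        \<open>pre\<close> does not apply. It is compared up to \<open>pM\<close>, and the head of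
        \<open>a\<close> is appended separately.\<close>
      have "pM \<notin> Suc ` bad j" using M2 sep by (auto simp: bad_def)
      then have "magnus_eq n ?P W (under_word U' (take pM (strand D' j)))"
        using pre[OF j, of pM] M2 k by (simp add: W_def)
      moreover have "under_word U' (take k (strand D' j))
          = under_word U' (take pM (strand D' j)) @ z"
        using M2 k e' dist by (simp add: len under_word_take_Suc under_word_Cons z_def U'_def)
      ultimately have "magnus_eq n ?P (W @ z) (under_word U' (take k (strand D' j)))"
        by (simp add: magnus_eq_append[OF F])
      from conj_gen_cong_off[OF magnus_eq_mono[OF this nonrep_off_subset]]
      show ?thesis using M2 e M oM by (simp add: U'_def N_def)
    next
      case bot
      then have "strand D' j ! k \<in> {strand D iB ! pB, strand D iB ! Suc pB}"
        using nB by auto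
      then show ?thesis using t B by (auto split: if_splits)
    next
      case top
      define k' where "k' = (if k = pT then Suc pT else pT)"
      have e: "strand D' j ! k = strand D j ! k'" and k': "k' < length (strand D j)"
        using nT top rng by (auto simp: k'_def)
      have W: "under_word U (take k' (strand D j)) = under_word U (take k (strand D j))"
        using top preT by (auto simp: k'_def)
      have tl: "ev_tail (strand D j ! k')" and c: "ev_id (strand D j ! k') \<noteq> c"
        using top T dist by (auto simp: k'_def)
      have nb: "k \<notin> Suc ` bad j" using top sep by (auto simp: bad_def)
      have "magnus_eq n ?P (U (ev_id (strand D j ! k'))) (conj_gen j (under_word U (take k
          (strand D j))))"
        using colD[OF j k' tl] W by simp
      also have "magnus_eq n ?P \<dots> (conj_gen j (under_word U' (take k (strand D' j))))"
        using conj_pre[OF j _ nb] k by simp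
      finally show ?thesis using c e by (simp add: U'_def)
    next
      case other
      have e: "strand D' j ! k = strand D j ! k" using nth[OF j(1) k] other by auto
      have c: "ev_id (strand D j ! k) \<noteq> c" using tail_c[OF j k] t e other by auto
      have nb: "k \<notin> Suc ` bad j" using other by (auto simp: bad_def)
      have "magnus_eq n ?P (U (ev_id (strand D j ! k))) (conj_gen j (under_word U (take k
          (strand D j))))"
        using colD[OF j k] t e by simp
      also have "magnus_eq n ?P \<dots> (conj_gen j (under_word U' (take k (strand D' j))))"
        using conj_pre[OF j _ nb] k by simp
      finally show ?thesis using c e by (simp add: U'_def)
    qed
  qed
  moreover have "same_longitudes n q D U D' U'"
    unfolding same_longitudes_def
  proof (intro allI impI)
    fix j assume j: "1 \<le> j" "j \<le> length D"
    have "length (strand D j) \<notin> Suc ` bad j" using rng by (auto simp: bad_def)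
    from pre[OF j order.refl this]
    show "magnus_eq n (nonrep_off q j) (under_word U (strand D j)) (under_word U' (strand D' j))"
      using magnus_eq_mono[OF _ nonrep_off_subset] by (simp add: len)
  qed
  ultimately show ?thesis using col unfolding matched_def by blast
qed

section \<open>Colourings compute Milnor numbers\<close>

definition word_subst :: "('g \<Rightarrow> 'h word) \<Rightarrow> 'g word \<Rightarrow> 'h word" where
  "word_subst f w = concat (map (\<lambda>(g, b). signed b (f g)) w)"

lemma word_subst_append [simp]: "word_subst f (v @ w) = word_subst f v @ word_subst f w"
  by (simp add: word_subst_def)

lemma word_subst_Nil [simp]: "word_subst f [] = []"
  by (simp add: word_subst_def)

lemma word_subst_Cons: "word_subst f (x # w) = signed (snd x) (f (fst x)) @ word_subst f w"
  by (simp add: word_subst_def case_prod_beta)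

lemma word_subst_winv: "word_subst f (winv w) = winv (word_subst f w)"
  by (induction w) (auto simp: winv_Cons word_subst_Cons winv_signed)

lemma word_subst_lcomm: "word_subst f (lcomm g gs) = lcomm (word_subst f g) (map (word_subst f) gs)"
  unfolding lcomm_def by (induction gs arbitrary: g) (auto simp: comm_def word_subst_winv)

text \<open>On a monomial of length at most \<open>p\<close>, the extreme cuts give the same sum for
  xy and yx, and every other cut involves a coefficient of \<open>x\<close> in a degree strictly
  between 0 and \<open>p\<close>, which is 0. So \<open>x\<close> and \<open>y\<close> commute below
  degree \<open>q\<close>.\<close>

lemma comm_vanishes:
  assumes "magnus_eq n (nonrep p) x []" "p \<le> q" "q \<le> Suc p"
  shows "magnus_eq n (nonrep q) (comm x y) []"
proof -
  note F = factor_closed_nonrep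
  have x: "[mcoef K x = 0] (mod int n)" if "distinct K" "length K < p" "K \<noteq> []" for K
    using assms(1) that by (auto simp: magnus_eq_def nonrep_def)
  have "magnus_eq n (nonrep q) (x @ y) (y @ x)"
    unfolding magnus_eq_def
  proof
    fix J assume J: "J \<in> nonrep q"
    let ?f = "\<lambda>k. mcoef (take k J) x * mcoef (drop k J) y"
    let ?g = "\<lambda>k. mcoef (take k J) y * mcoef (drop k J) x"
    show "[mcoef J (x @ y) = mcoef J (y @ x)] (mod int n)"
    proof (cases "J = []")
      case False
      have "{..length J} = {0, length J} \<union> {1..<length J}" using False by auto
      then have split: "sum h {..length J} = h 0 + h (length J) + sum h {1..<length J}" for h ::
          "nat \<Rightarrow> int"
        using False by (simp add: sum.union_disjoint)
      have "[sum ?f {1..<length J} = (\<Sum>k\<in>{1..<length J}. 0)] (mod int n)"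
        using J assms(3) by (intro cong_sum)
            (force simp: nonrep_def cong_0_iff intro: dvd_mult2 x[unfolded cong_0_iff])
      moreover have "[sum ?g {1..<length J} = (\<Sum>k\<in>{1..<length J}. 0)] (mod int n)"
        using J assms(3) by (intro cong_sum)
            (force simp: nonrep_def cong_0_iff intro: dvd_mult x[unfolded cong_0_iff])
      ultimately have "[sum ?f {1..<length J} = sum ?g {1..<length J}] (mod int n)"
        using cong_trans cong_sym by blast
      then show ?thesis
        unfolding mcoef_append split by (simp add: add.commute cong_add_lcancel)
    qed simp
  qed
  from magnus_eq_append[OF F magnus_eq_refl[of n _ "winv x @ winv y"] this]
  have "magnus_eq n (nonrep q) (comm x y) (winv (y @ x) @ (y @ x))"
    by (simp add: comm_def)
  also have "magnus_eq n (nonrep q) \<dots> []" by (rule magnus_eq_left_inverse[OF F])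
  finally show ?thesis .
qed

text \<open>Each further commutator gains one degree by \<open>comm_vanishes\<close>, starting from
  the fact that every word has constant term 1.\<close>

lemma lcomm_vanishes: "magnus_eq n (nonrep (Suc (length gs))) (lcomm g gs) []"
proof (induction gs rule: rev_induct)
  case Nil
  then show ?case by (simp add: magnus_eq_def nonrep_def)
next
  case (snoc y gs)
  then show ?case using comm_vanishes[OF snoc, of "Suc (Suc (length gs))" y]
      by (simp add: lcomm_def)
qed

text \<open>\<open>U\<close> is indexed by crossings, but the relators mention every arc. Exactly
  \<open>j - 1\<close> heads precede the \<open>j\<close>-th arc of a strand.\<close>

definition arc_word :: "gdiag \<Rightarrow> (nat \<Rightarrow> nat word) \<Rightarrow> nat \<times> nat \<Rightarrow> nat word" where
  "arc_word D U = (\<lambda>(i, j). conj_gen i (under_word U (take (j - 1) (heads_of D i))))"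

lemma take_heads_before:
  "take (heads_before xs k) (filter (\<lambda>e. \<not> ev_tail e) xs) = filter (\<lambda>e. \<not> ev_tail e) (take k xs)"
proof -
  have "filter (\<lambda>e. \<not> ev_tail e) xs
      = filter (\<lambda>e. \<not> ev_tail e) (take k xs) @ filter (\<lambda>e. \<not> ev_tail e) (drop k xs)"
    by (metis append_take_drop_id filter_append)
  then show ?thesis by (simp add: heads_before_def)
qed

lemma wf_gd_tail_exists:
  assumes wf: "wf_gd m D" and e: "e \<in> set (concat D)"
  obtains i k where "1 \<le> i" "i \<le> length D" "k < length (strand D i)"
      "strand D i ! k = (ev_id e, True, ev_pos e)"
proof -
  have "ev_id e \<in> ids D" using e by (simp add: ids_def)
  then have "length (filter (\<lambda>x. ev_id x = ev_id e \<and> ev_tail x) (concat D)) = 1"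
    using wf by (simp add: wf_gd_def)
  then have "filter (\<lambda>x. ev_id x = ev_id e \<and> ev_tail x) (concat D) \<noteq> []" by auto
  then obtain x where x: "x \<in> set (concat D)" "ev_id x = ev_id e" "ev_tail x"
    unfolding filter_empty_conv by blast
  then have "ev_pos x = ev_pos e" using wf e unfolding wf_gd_def by blast
  then have xe: "x = (ev_id e, True, ev_pos e)"
    using x by (cases x) simp
  obtain a k where "a < length D" "k < length (D ! a)" "D ! a ! k = x"
    using x(1) by (auto simp: in_set_conv_nth)
  then show thesis using that[of "Suc a" k] xe by (simp add: strand_def)
qed

lemma heads_of_mem:
  "1 \<le> i \<Longrightarrow> i \<le> length D \<Longrightarrow> e \<in> set (heads_of D i) \<Longrightarrow> e \<in> set (concat D) \<and> \<not> ev_tail e"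
  by (auto simp: heads_of_def strand_def intro!: bexI[of _ "D ! (i - 1)"])

lemma tail_arc_witness:
  assumes wf: "wf_gd m D" and e: "e \<in> set (concat D)"
  obtains i k s where "1 \<le> i" "i \<le> length D" "k < length (strand D i)"
      "strand D i ! k = (ev_id e, True, s)"
    "tail_arc D (ev_id e) = (i, Suc (heads_before (strand D i) k))"
proof -
  obtain i k where "1 \<le> i" "i \<le> length D" "k < length (strand D i)"
      "strand D i ! k = (ev_id e, True, ev_pos e)"
    by (rule wf_gd_tail_exists[OF assms])
  then have "\<exists>ij i k s. 1 \<le> i \<and> i \<le> length D \<and> k < length (strand D i) \<and>
       strand D i ! k = (ev_id e, True, s) \<and> ij = (i, 1 + heads_before (strand D i) k)" by blast
  from someI_ex[OF this] that show thesis unfolding tail_arc_def by auto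
qed

lemma arc_word_tail_arc:
  assumes wf: "wf_gd m D" and col: "colouring n q D U" and e: "e \<in> set (concat D)"
  shows "magnus_eq n (nonrep q) (arc_word D U (tail_arc D (ev_id e))) (U (ev_id e))"
proof -
  obtain i k s where i: "1 \<le> i" "i \<le> length D" "k < length (strand D i)"
      "strand D i ! k = (ev_id e, True, s)"
    "tail_arc D (ev_id e) = (i, Suc (heads_before (strand D i) k))"
    by (rule tail_arc_witness[OF wf e])
  then have "arc_word D U (tail_arc D (ev_id e)) = conj_gen i (under_word U (take k (strand D i)))"
    by (simp add: arc_word_def heads_of_def take_heads_before under_word_heads)
  then show ?thesis
    using col[unfolded colouring_def, rule_format, of i k] i by (simp add: magnus_eq_sym)
qed

lemma word_subst_u_letters:
  assumes wf: "wf_gd m D" and col: "colouring n q D U" and i: "1 \<le> i" "i \<le> length D"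
    and j: "j \<le> length (heads_of D i)"
  shows "magnus_eq n (nonrep q) (word_subst (arc_word D U) (map (u_letter D i) [1..<Suc j]))
    (under_word U (take j (heads_of D i)))"
  using j
proof (induction j)
  case (Suc j)
  let ?e = "heads_of D i ! j"
  have e: "?e \<in> set (concat D)" "\<not> ev_tail ?e" using heads_of_mem[OF i, of ?e] Suc.prems by simp_all
  have "magnus_eq n (nonrep q) (word_subst (arc_word D U) [u_letter D i (Suc j)])
      (under_word U [?e])"
    using arc_word_tail_arc[OF wf col e(1)] e(2)
    by (simp add: u_letter_def word_subst_Cons under_word_Cons Let_def magnus_eq_signed
        factor_closed_nonrep)
  from magnus_eq_append[OF factor_closed_nonrep Suc.IH this] Suc.prems show ?case
    by (simp add: take_Suc_conv_app_nth)
qed simp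

lemma word_subst_vword:
  assumes "wf_gd m D" "colouring n q D U" "1 \<le> i" "i \<le> length D"
  shows "magnus_eq n (nonrep q) (word_subst (arc_word D U) (vword D i)) (under_word U (strand D i))"
  using word_subst_u_letters[OF assms order.refl]
      by (simp add: vword_def heads_of_def under_word_heads)

text \<open>The prefix of arc \<open>j + 1\<close> has one head more than that of arc
  \<open>j\<close>, so its colour is already the conjugate demanded by the relator.\<close>

lemma word_subst_relator:
  assumes wf: "wf_gd m D" and col: "colouring n q D U" and i: "1 \<le> i" "i \<le> length D"
    and j: "1 \<le> j" "j \<le> length (heads_of D i)"
  shows "magnus_eq n (nonrep q) (word_subst (arc_word D U) (relator D i j)) []"
proof -
  let ?e = "heads_of D i ! (j - 1)" and ?u = "word_subst (arc_word D U) [u_letter D i j]"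
  note F = factor_closed_nonrep
  have e: "?e \<in> set (concat D)" "\<not> ev_tail ?e" using heads_of_mem[OF i, of ?e] j by simp_all
  have u: "magnus_eq n (nonrep q) ?u (under_word U [?e])"
    using arc_word_tail_arc[OF wf col e(1)] e(2)
    by (simp add: u_letter_def word_subst_Cons under_word_Cons Let_def magnus_eq_signed F)
  have "take j (heads_of D i) = take (j - 1) (heads_of D i) @ [?e]"
    using j by (metis Suc_diff_le Suc_le_lessD diff_Suc_1 take_Suc_conv_app_nth One_nat_def)
  then have next_arc: "arc_word D U (i, j + 1)
      = winv (under_word U [?e]) @ arc_word D U (i, j) @ under_word U [?e]"
    by (simp add: arc_word_def conj_gen_def)
  have "magnus_eq n (nonrep q) (winv ?u @ arc_word D U (i, j) @ ?u) (arc_word D U (i, j + 1))"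
    unfolding next_arc by (intro magnus_eq_append F magnus_eq_winv u magnus_eq_refl)
  from magnus_eq_append[OF F magnus_eq_refl[of n _ "winv (arc_word D U (i, j + 1))"] this]
  have "magnus_eq n (nonrep q) (winv (arc_word D U (i, j + 1)) @ winv ?u @ arc_word D U
      (i, j) @ ?u) []"
    using magnus_eq_left_inverse[OF F] magnus_eq_trans by blast
  moreover have "word_subst (arc_word D U) (relator D i j)
      = winv (arc_word D U (i, j + 1)) @ winv ?u @ arc_word D U (i, j) @ ?u"
    unfolding relator_def word_subst_append word_subst_winv
        by (simp add: word_subst_Cons signed_def)
  ultimately show ?thesis by simp
qed

text \<open>A colouring induces a homomorphism from the group modulo its \<open>q\<close>-th lower
  central term to the units of the truncated ring: relators evaluate to 1, and commutators of weight
  \<open>q\<close> vanish below degree \<open>q\<close>.\<close>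

lemma gcong_sound:
  assumes wf: "wf_gd m D" and col: "colouring n q D U" and g: "gcong D q v w"
  shows "magnus_eq n (nonrep q) (word_subst (arc_word D U) v) (word_subst (arc_word D U) w)"
  using g
proof (induction rule: gcong.induct)
  case (cancel g b)
  then show ?case
    using magnus_eq_right_inverse[OF factor_closed_nonrep, of n q "signed b (arc_word D U g)"]
    by (simp add: word_subst_Cons winv_signed)
next
  case (lcs gs g)
  then show ?case using lcomm_vanishes[of n "map (word_subst (arc_word D U)) gs"]
    by (simp add: word_subst_lcomm)
next
  case (ctxt w w' x y)
  then show ?case by (simp add: magnus_eq_append factor_closed_nonrep)
next
  case (rel i j)
  then show ?case by (simp add: word_subst_relator[OF wf col])
next
  case (trans w w' w'')
  then show ?case by (blast intro: magnus_eq_trans)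
qed (simp_all add: magnus_eq_sym)

section \<open>Reduction of group elements to words in the meridians\<close>

declare gcong.trans [trans]

lemma gcong_append: "gcong D q v v' \<Longrightarrow> gcong D q w w' \<Longrightarrow> gcong D q (v @ w) (v' @ w')"
  using gcong.ctxt[of D q v v' "[]" w] gcong.ctxt[of D q w w' v' "[]"] gcong.trans by fastforce

lemma gcong_right_inverse: "gcong D q (w @ winv w) []"
proof (induction w)
  case (Cons x w)
  have "gcong D q ([x] @ (w @ winv w) @ [(fst x, \<not> snd x)]) ([x] @ [] @ [(fst x, \<not> snd x)])"
    by (rule gcong.ctxt[OF Cons])
  also have "gcong D q \<dots> []" using gcong.cancel[of D q "fst x" "snd x"] by simp
  finally show ?case by (simp add: winv_Cons)
qed (simp add: gcong.refl)

lemma gcong_left_inverse: "gcong D q (winv w @ w) []"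
  using gcong_right_inverse[of D q "winv w"] by simp

lemma gcong_winv:
  assumes "gcong D q v w"
  shows "gcong D q (winv v) (winv w)"
proof -
  have "gcong D q (winv v) (winv v @ w @ winv w)"
    using gcong_append[OF gcong.refl[of D q "winv v"] gcong.sym[OF gcong_right_inverse[of D q w]]]
        by simp
  also have "gcong D q (winv v @ w @ winv w) (winv v @ v @ winv w)"
    by (intro gcong_append gcong.refl gcong.sym[OF assms])
  also have "gcong D q (winv v @ v @ winv w) (winv w)"
    using gcong_append[OF gcong_left_inverse[of D q v] gcong.refl[of D q "winv w"]] by simp
  finally show ?thesis .
qed

text \<open>Elements that agree modulo $\Gamma_q$ differ by an element that is central modulo
  $\Gamma_{q+1}$.\<close>
lemma gcong_conjugate:
  assumes "gcong D q v w"
  shows "gcong D (Suc q) (winv v @ x @ v) (winv w @ x @ w)"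
  using assms
proof (induction arbitrary: x rule: gcong.induct)
  case (sym w w')
  then show ?case by (blast intro: gcong.sym)
next
  case (trans w w' w'')
  then show ?case by (blast intro: gcong.trans)
next
  case (ctxt w w' y z)
  from gcong.ctxt[OF ctxt.IH[of "winv y @ x @ y"], of "winv z" z] show ?case by simp
next
  case (cancel g b)
  have "gcong D (Suc q) (winv [(g, b), (g, \<not> b)] @ x @ [(g, b), (g, \<not> b)]) (winv [] @ x @ [])"
    by (intro gcong_append gcong_winv gcong.cancel gcong.refl)
  then show ?case .
next
  case (rel i j)
  then show ?case by (intro gcong_append gcong_winv gcong.rel gcong.refl)
next
  case (lcs gs g)
  let ?L = "lcomm g gs"
  have "gcong D (Suc q) (comm ?L x) []"
    using gcong.lcs[of "gs @ [x]" "Suc q" D g] lcs by (simp add: lcomm_def)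
  from gcong_append[OF gcong.refl[of D "Suc q" x] gcong_winv[OF this]]
  have "gcong D (Suc q) (x @ winv x @ winv ?L @ x @ ?L) x"
    by (simp add: comm_def)
  moreover have "gcong D (Suc q) (x @ winv x @ winv ?L @ x @ ?L) (winv ?L @ x @ ?L)"
    using gcong_append[OF gcong_right_inverse gcong.refl] by fastforce
  ultimately show ?case by (simp) (blast intro: gcong.sym gcong.trans)
qed (rule gcong.refl)

definition arcs :: "gdiag \<Rightarrow> (nat \<times> nat) set" where
  "arcs D = {(i, j). 1 \<le> i \<and> i \<le> length D \<and> 1 \<le> j \<and> j \<le> Suc (length (heads_of D i))}"

lemma tail_arc_in_arcs:
  assumes "wf_gd m D" "e \<in> set (concat D)"
  shows "tail_arc D (ev_id e) \<in> arcs D"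
proof -
  obtain i k s where "1 \<le> i" "i \<le> length D"
      "tail_arc D (ev_id e) = (i, Suc (heads_before (strand D i) k))"
    by (rule tail_arc_witness[OF assms])
  moreover have "heads_before xs k \<le> length (filter (\<lambda>e. \<not> ev_tail e) xs)" for xs :: "ev list"
    unfolding heads_before_def
    by (metis append_take_drop_id filter_append length_append le_add1)
  ultimately show ?thesis by (simp add: arcs_def heads_of_def)
qed

lemma u_letter_in_arcs:
  assumes "wf_gd m D" "1 \<le> i" "i \<le> length D" "1 \<le> j" "j \<le> length (heads_of D i)"
  shows "fst (u_letter D i j) \<in> arcs D"
  using assms heads_of_mem[OF assms(2,3), of "heads_of D i ! (j - 1)"]
  by (simp add: u_letter_def Let_def tail_arc_in_arcs)

lemma gcong_arc_step:
  assumes "1 \<le> i" "i \<le> length D" "1 \<le> j" "j \<le> length (heads_of D i)"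
  shows "gcong D q [((i, Suc j), True)]
      (winv [u_letter D i j] @ [((i, j), True)] @ [u_letter D i j])"
proof -
  let ?w = "winv [u_letter D i j] @ [((i, j), True)] @ [u_letter D i j]"
  have "gcong D q [((i, Suc j), True)] ([((i, Suc j), True)] @ relator D i j)"
    using gcong_append[OF gcong.refl[of D q "[((i, Suc j), True)]"]
        gcong.sym[OF gcong.rel[OF assms, of q]]] by simp
  also have "gcong D q ([((i, Suc j), True)] @ relator D i j) ?w"
    using gcong_append[OF gcong.cancel[of D q "(i, Suc j)" True] gcong.refl[of D q ?w]]
    by (simp add: relator_def)
  finally show ?thesis .
qed

lemma gcong_arc:
  assumes i: "1 \<le> i" "i \<le> length D" and j: "j \<le> length (heads_of D i)"
  shows "gcong D q [((i, Suc j), True)]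
    (winv (map (u_letter D i) [1..<Suc j]) @ [((i, 1), True)] @ map (u_letter D i) [1..<Suc j])"
  using j
proof (induction j)
  case 0
  then show ?case by (simp add: gcong.refl)
next
  case (Suc j)
  let ?u = "u_letter D i (Suc j)"
  have "gcong D q [((i, Suc (Suc j)), True)] (winv [?u] @ [((i, Suc j), True)] @ [?u])"
    using Suc.prems by (intro gcong_arc_step i) auto
  also have "gcong D q \<dots> (winv [?u] @ (winv (map (u_letter D i) [1..<Suc j]) @ [((i, 1), True)] @
      map (u_letter D i) [1..<Suc j]) @ [?u])"
    using Suc by (intro gcong.ctxt) simp
  finally show ?case by simp
qed

abbreviation meridian_word :: "nat word \<Rightarrow> (nat \<times> nat) word" where
  "meridian_word lam \<equiv> map (\<lambda>(j, b). ((j, 1), b)) lam"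

lemma meridian_word_winv: "meridian_word (winv w) = winv (meridian_word w)"
  by (induction w) (auto simp: winv_Cons)

text \<open>An arc is a conjugate of the first arc of its strand. By induction the conjugator is a
  word in the meridians modulo weight \<open>q\<close>, and by \<open>gcong_conjugate\<close> this
  determines the arc modulo weight \<open>q + 1\<close>. Hence the choice in \<open>mu\<close> has a
  witness.\<close>

lemma gcong_meridians:
  assumes wf: "wf_gd m D" and q: "1 \<le> q"
  shows "fst ` set w \<subseteq> arcs D \<Longrightarrow>
      \<exists>lam. fst ` set lam \<subseteq> {1..length D} \<and> gcong D q w (meridian_word lam)"
  using q
proof (induction q arbitrary: w rule: dec_induct)
  case base
  \<comment> \<open>Commutators of weight 1 are arbitrary words, so at the first stage everything is
    trivial.\<close>
  have "gcong D 1 w []" using gcong.lcs[of "[]" 1 D w] by (simp add: lcomm_def)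
  then show ?case by (intro exI[of _ "[]"]) simp
next
  case (step q)
  have arc: "\<exists>lam. fst ` set lam \<subseteq> {1..length D} \<and> gcong D (Suc q) [(a, True)] (meridian_word lam)"
    if a_arc: "a \<in> arcs D" for a
  proof -
    obtain i j where a: "a = (i, Suc j)" and i: "1 \<le> i" "i \<le> length D"
        and j: "j \<le> length (heads_of D i)"
    proof -
      from a_arc have "a = (fst a, Suc (snd a - 1))" "1 \<le> fst a" "fst a \<le> length D"
        "snd a - 1 \<le> length (heads_of D (fst a))"
        by (auto simp: arcs_def)
      then show thesis by (rule that)
    qed
    let ?v = "map (u_letter D i) [1..<Suc j]"
    have "fst ` set ?v \<subseteq> arcs D" using u_letter_in_arcs[OF wf i] j by auto
    from step.IH[OF this] obtain lam where lam: "fst ` set lam \<subseteq> {1..length D}"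
      "gcong D q ?v (meridian_word lam)" by blast
    have "gcong D (Suc q) [(a, True)] (winv ?v @ [((i, 1), True)] @ ?v)"
      unfolding a by (rule gcong_arc[OF i j])
    also have "gcong D (Suc q) \<dots> (winv (meridian_word lam) @ [((i, 1), True)] @ meridian_word lam)"
      by (rule gcong_conjugate[OF lam(2)])
    finally have "gcong D (Suc q) [(a, True)] (meridian_word (conj_gen i lam))"
      by (simp only: conj_gen_def map_append meridian_word_winv list.map case_prod_conv)
    moreover have "fst ` set (conj_gen i lam) \<subseteq> {1..length D}"
      using lam(1) i by (force simp: conj_gen_def winv_def)
    ultimately show ?thesis by blast
  qed
  have letter: "\<exists>lam. fst ` set lam \<subseteq> {1..length D} \<and> gcong D (Suc q) [(a, b)] (meridian_word lam)"
    if a: "a \<in> arcs D" for a b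
  proof -
    obtain lam where lam: "fst ` set lam \<subseteq> {1..length D}"
        "gcong D (Suc q) [(a, True)] (meridian_word lam)"
      using arc[OF a] by blast
    show ?thesis
    proof (cases b)
      case True
      then show ?thesis using lam by (intro exI[of _ lam]) simp
    next
      case False
      have "gcong D (Suc q) [(a, b)] (meridian_word (winv lam))"
        using gcong_winv[OF lam(2)] False unfolding meridian_word_winv by simp
      moreover have "fst ` set (winv lam) \<subseteq> {1..length D}" using lam(1) by (force simp: winv_def)
      ultimately show ?thesis by blast
    qed
  qed
  from step.prems show ?case
  proof (induction w)
    case Nil
    then show ?case by (intro exI[of _ "[]"]) (simp add: gcong.refl)
  next
    case (Cons x w)
    obtain lam1 where 1: "fst ` set lam1 \<subseteq> {1..length D}" "gcong D (Suc q) w (meridian_word lam1)"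
      using Cons by auto
    obtain lam2 where 2: "fst ` set lam2 \<subseteq> {1..length D}" "gcong D (Suc q) [x] (meridian_word lam2)"
      using letter[of "fst x" "snd x"] Cons.prems by auto
    have "gcong D (Suc q) (x # w) (meridian_word (lam2 @ lam1))"
      using gcong_append[OF 2(2) 1(2)] by simp
    moreover have "fst ` set (lam2 @ lam1) \<subseteq> {1..length D}" using 1(1) 2(1) by auto
    ultimately show ?case by blast
  qed
qed

text \<open>First arcs have an empty prefix, so their colours are the meridians themselves and
  evaluation returns \<open>lam\<close> literally.\<close>

lemma word_subst_meridian: "word_subst (arc_word D U) (meridian_word lam) = lam"
  by (induction lam) (auto simp: word_subst_Cons arc_word_def conj_gen_def signed_def)

text \<open>The framing factor evaluates to a power of \<alpha>_i, which is 1 modulo X_i for any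
  exponent.\<close>

lemma word_subst_longitude:
  assumes wf: "wf_gd m D" and col: "colouring n q D U" and i: "1 \<le> i" "i \<le> length D"
  shows "magnus_eq n (nonrep_off q i) (word_subst (arc_word D U) (longitude D i)) (under_word U
      (strand D i))"
proof -
  note F = factor_closed_nonrep_off
  have t: "magnus_eq n (nonrep_off q i) (signed b (arc_word D U (i, 1))) []" for b
    by (rule signed_trivial_off[of _ _ _ _ "[]"]) (simp add: arc_word_def)
  have r: "magnus_eq n (nonrep_off q i) (word_subst (arc_word D U) (replicate k
      ((i, 1), b))) []" for k b
  proof (induction k)
    case (Suc k)
    show ?case using magnus_eq_append[OF F t[of b] Suc] by (simp add: word_subst_Cons)
  qed simp
  have "magnus_eq n (nonrep_off q i) (word_subst (arc_word D U) (wpow (i, 1) s)) []" for s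
    using r by (simp add: wpow_def)
  from magnus_eq_append[OF F this magnus_eq_mono[OF word_subst_vword[OF wf col i]
      nonrep_off_subset]]
  show ?thesis by (simp add: longitude_def)
qed

section \<open>Milnor numbers modulo n and their invariance\<close>

lemma butlast_nonrep_off:
  assumes "I \<noteq> []" "distinct I"
  shows "butlast I \<in> nonrep_off (length I) (last I)"
  using assms by (cases I rule: rev_cases) (auto simp: nonrep_off_def)

text \<open>Evaluating the congruence satisfied by the chosen \<open>lam\<close> returns
  \<open>lam\<close> on one side and the word of strand \<open>last I\<close> on the other. The
  degree of \<open>butlast I\<close> is below the truncation \<open>length I\<close>, so its
  coefficient is preserved.\<close>

lemma mu_colouring:
  assumes wf: "wf_gd m D" and I: "I \<noteq> []" "distinct I" "set I \<subseteq> {1..m}"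
    and col: "colouring n (length I) D U"
  shows "[mu D I = mcoef (butlast I) (under_word U (strand D (last I)))] (mod int n)"
proof -
  let ?q = "length I" and ?i = "last I" and ?J = "butlast I"
  have i: "1 \<le> ?i" "?i \<le> length D"
    using subsetD[OF I(3) last_in_set[OF I(1)]] wf by (simp_all add: wf_gd_def)
  have J: "?J \<in> nonrep_off ?q ?i" by (rule butlast_nonrep_off[OF I(1,2)])
  let ?ok = "\<lambda>lam. fst ` set lam \<subseteq> {1..length D} \<and> gcong D ?q (longitude D ?i) (meridian_word lam)"
  define lam where "lam = (SOME lam. ?ok lam)"
  have "fst ` set (vword D ?i) \<subseteq> arcs D"
    using u_letter_in_arcs[OF wf i] by (auto simp: vword_def)
  then have "fst ` set (longitude D ?i) \<subseteq> arcs D"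
    using i by (auto simp: longitude_def wpow_def arcs_def split: if_splits)
  then have "\<exists>lam. ?ok lam"
    using I by (intro gcong_meridians[OF wf]) (simp_all add: Suc_le_eq)
  then have "?ok lam" unfolding lam_def by (rule someI_ex)
  then have "magnus_eq n (nonrep ?q) (word_subst (arc_word D U) (longitude D ?i)) lam"
    using gcong_sound[OF wf col, of "longitude D ?i" "meridian_word lam"]
    unfolding word_subst_meridian by blast
  then have "magnus_eq n (nonrep_off ?q ?i) lam (word_subst (arc_word D U) (longitude D ?i))"
    by (rule magnus_eq_sym[OF magnus_eq_mono[OF _ nonrep_off_subset]])
  also have "magnus_eq n (nonrep_off ?q ?i) \<dots> (under_word U (strand D ?i))"
    by (rule word_subst_longitude[OF wf col i])
  finally show ?thesis
    using J unfolding magnus_eq_def mu_def lam_def by blast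
qed

text \<open>For moves that insert crossings the colouring is first chosen on the larger diagram
  \<open>D'\<close>; for R3, OC and renaming it is chosen on \<open>D\<close>.\<close>

lemma matched_step:
  assumes "Vn_sv_step n m D D'"
  shows "wf_gd m D \<and> wf_gd m D' \<and> matched n q D D'"
proof -
  have wf: "wf_gd m D" "wf_gd m D'"
    using assms by (auto simp: Vn_sv_step_def welded_step_def)
  note col = colouring_exists[OF wf(1), of n q] colouring_exists[OF wf(2), of n q]
  show ?thesis
    using assms wf matched_R1[OF col(2)] matched_R2[OF col(2)] matched_R3[OF wf(1) col(1)]
      matched_OC[OF col(1)] matched_rename[OF col(1)] matched_Vn_move[OF col(2)]
          matched_sv_move[OF col(2)]
    by (auto simp: Vn_sv_step_def welded_step_def)
qed

lemma mu_step:
  assumes step: "Vn_sv_step n m D D'" and I: "I \<noteq> []" "distinct I" "set I \<subseteq> {1..m}"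
  shows "[mu D I = mu D' I] (mod int n)"
proof -
  have wf: "wf_gd m D" "wf_gd m D'" and "matched n (length I) D D'"
    using matched_step[OF step] by auto
  then obtain U U' where col: "colouring n (length I) D U" "colouring n (length I) D' U'"
    and same: "same_longitudes n (length I) D U D' U'"
    unfolding matched_def by blast
  have i: "1 \<le> last I" "last I \<le> length D"
    using subsetD[OF I(3) last_in_set[OF I(1)]] wf(1) by (simp_all add: wf_gd_def)
  have "[mcoef (butlast I) (under_word U (strand D (last I)))
      = mcoef (butlast I) (under_word U' (strand D' (last I)))] (mod int n)"
    using same i butlast_nonrep_off[OF I(1,2)] unfolding same_longitudes_def magnus_eq_def by blast
  then show ?thesis
    using mu_colouring[OF wf(1) I col(1)] mu_colouring[OF wf(2) I col(2)]
        by (meson cong_sym cong_trans)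
qed

theorem theorem3p1:
  fixes n m :: nat and D D' :: gdiag and I :: "nat list"
  assumes "0 < n"
    and "wf_gd m D" and "wf_gd m D'"
    and "Vn_sv_equiv n m D D'"
    and "I \<noteq> []" and "distinct I" and "set I \<subseteq> {1..m}"
  shows "[mu D I = mu D' I] (mod int n)"
  using assms(4) unfolding Vn_sv_equiv_def
proof (induction rule: rtranclp_induct)
  case (step E E')
  then have "[mu E I = mu E' I] (mod int n)"
    using mu_step[OF _ assms(5-7)] cong_sym by blast
  with step.IH show ?case by (rule cong_trans)
qed simp

end
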